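(* Let $(X,\mathcal{B},\mu)$ be a probability space, $b\in(1,\infty]$, $\psi\in\Psi(b)$, and let $\lambda>\nu\ge0$, $\Delta=\lambda-\nu$. Let $Q$ be a (not necessarily linear) operator acting from $L_p(X,\mu)$ into $L_p(X,\mu)$ for every $p\in(1,\infty)$, and suppose there is a finite constant $Z=Z(Q)$ such that $$|Q[f]|_p\le Z\,\frac{p^{\lambda}}{(p-1)^{\nu}}\,|f|_p,\qquad p\in[1,b)$$ (for $\nu>0$ the right-hand side is read as $+\infty$ at $p=1$). Put $\zeta(p)=\zeta[\psi,\Delta](p)=p^{\Delta}\psi(p)$, $p\in[1,b)$. Suppose $f\in G\psi$. Then the function $g=Q[f]$ belongs to the (other) Grand Lebesgue Space $G\zeta$, or equivalently to the corresponding exponential Orlicz space $L(M_\zeta)$, and $$\|g\|_{G\zeta}\le Z\,K_\nu[\zeta,b]\,\|f\|_{G\psi},$$ or equally, in terms of exponential Orlicz spaces, $$\|g\|_{L(M_\zeta)}\le C(\psi)\,K_\nu[\zeta,b]\,Z(Q)\,\|f\|_{L(M_\psi)},$$ where $C(\psi)$ is a finite constant depending on $\psi$.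
   Context: $|f|_p=\left[\int_X|f|^p\,d\mu\right]^{1/p}$ is the usual $L_p(X,\mu)$ norm. For $b\in(1,\infty]$, $\Psi(b)$ is the set of functions $\psi$ that are finite and continuous on $[1,b)$, bounded from below by a positive constant and normalized (without loss of generality) by $\inf_{p\in[1,b)}\psi(p)=1$, with $b=\sup\{p:\psi(p)<\infty\}$. For $\varphi=\psi$ or $\varphi=\zeta$, the Grand Lebesgue Space $G\varphi$ consists of all real (or complex) valued measurable functions $f$ on $X$ with finite norm $\|f\|_{G\varphi}=\sup_{p\in[1,b)}|f|_p/\varphi(p)$. The constant $K_\nu[\zeta,b]$ is $$K_\nu[\zeta,b]=\inf_{q\in(1,b)}\frac{q^\nu\,\zeta(q)}{(q-1)^\nu}.$$ For $\varphi=\psi$ or $\varphi=\zeta$, the Young–Orlicz function $M_\varphi$ is $M_\varphi(y)=\exp\left(v_\varphi^*(\ln|y|)\right)$ for $|y|\ge e$ and $M_\varphi(y)=C_0y^2$ for $|y|<e$ ($C_0>0$ a constant), where $v_\varphi(p)=p\ln\varphi(p)$ and $v_\varphi^*(u)=\sup_{p}(pu-v_\varphi(p))$ is its Young–Fenchel transform, the supremum being over the $p\ge1$ with $\varphi(p)<\infty$. $L(M_\varphi)$ is the (exponential) Orlicz space over $(X,\mathcal{B},\mu)$ with Young–Orlicz function $M_\varphi$.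
   Formalization: Membership of g in L(M_ζ) is asserted only when f is in L(M_ψ), since f in Gψ alone does not suffice (b=2, f=x^(-1/2) on (0,1), ψ=|f|_p/2, Q=identity); the constant C(ψ) may also depend on b, λ, ν and C_0. *)

theory Defs
  imports "HOL-Probability.Probability_Measure"
begin

text \<open>
  Scalar-valued functions are polymorphic in the value type. The theorem uses the sort
  \<open>{real_normed_field, euclidean_space}\<close>, which both the reals and the complex numbers
  inhabit.
\<close>

subsection \<open>Lebesgue spaces\<close>

definition Lp_norm :: "'a measure \<Rightarrow> real \<Rightarrow> ('a \<Rightarrow> 'k::real_normed_vector) \<Rightarrow> ennreal" where
  "Lp_norm M p f =
     (if integrable M (\<lambda>x. norm (f x) powr p)
      then ennreal ((\<integral>x. norm (f x) powr p \<partial>M) powr (1 / p)) else \<infinity>)"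

definition Lp_space :: "'a measure \<Rightarrow> real \<Rightarrow> ('a \<Rightarrow> 'k::real_normed_vector) set" where
  "Lp_space M p = {f \<in> borel_measurable M. Lp_norm M p f < \<infinity>}"

text \<open>
  Elements of the Lebesgue spaces are represented by functions rather than by classes modulo
  almost everywhere equality, so an operator on them has to respect that equality. The values of
  \<open>Q\<close> outside the union of the spaces with exponent \<open>p > 1\<close> are
  irrelevant.
\<close>

definition operator_on_Lp ::
    "'a measure \<Rightarrow> (('a \<Rightarrow> 'k::real_normed_vector) \<Rightarrow> ('a \<Rightarrow> 'k)) \<Rightarrow> bool" where
  "operator_on_Lp M Q \<longleftrightarrow>
     (\<forall>p>1. (\<forall>f \<in> Lp_space M p. Q f \<in> Lp_space M p) \<and>
       (\<forall>f \<in> Lp_space M p. \<forall>g \<in> Lp_space M p.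
          (AE x in M. f x = g x) \<longrightarrow> (AE x in M. Q f x = Q g x)))"

text \<open>
  The case distinctions fix the endpoint \<open>p = 1\<close>: the bound is infinite there for
  \<open>\<nu> > 0\<close>, and for \<open>\<nu> = 0\<close> the factor \<open>(p - 1)\<close>
  to the power \<open>\<nu>\<close> is 1 (whereas \<open>0 powr 0 = 0\<close>).
\<close>

definition growth_bound :: "real \<Rightarrow> real \<Rightarrow> real \<Rightarrow> real \<Rightarrow> ennreal \<Rightarrow> ennreal" where
  "growth_bound Z lam \<nu> p N =
     (if p = 1 \<and> \<nu> > 0 then \<infinity>
      else ennreal (Z * (p powr lam / (if \<nu> = 0 then 1 else (p - 1) powr \<nu>))) * N)"

text \<open>
  At \<open>p = 1\<close> the estimate is only required on the domain of the operator, which is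
  the union of the spaces with exponent \<open>r > 1\<close>.
\<close>

definition Lp_growth ::
    "'a measure \<Rightarrow> ereal \<Rightarrow> real \<Rightarrow> real \<Rightarrow> real
      \<Rightarrow> (('a \<Rightarrow> 'k::real_normed_vector) \<Rightarrow> ('a \<Rightarrow> 'k)) \<Rightarrow> bool" where
  "Lp_growth M b Z lam \<nu> Q \<longleftrightarrow>
     (\<forall>p. 1 \<le> p \<and> ereal p < b \<longrightarrow>
       (\<forall>f \<in> Lp_space M p \<inter> (\<Union>r\<in>{1<..}. Lp_space M r).
          Lp_norm M p (Q f) \<le> growth_bound Z lam \<nu> p (Lp_norm M p f)))"


subsection \<open>Grand Lebesgue spaces\<close>

text \<open>
  Generating functions are extended valued, so that the condition that \<open>b\<close> is the
  supremum of the points of finiteness can be stated; values at arguments below 1 are never used.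
\<close>

definition Psi :: "ereal \<Rightarrow> (real \<Rightarrow> ennreal) set" where
  "Psi b = {\<psi>.
     (\<forall>p. 1 \<le> p \<and> ereal p < b \<longrightarrow> \<psi> p < \<infinity>) \<and>
     continuous_on {p. 1 \<le> p \<and> ereal p < b} \<psi> \<and>
     (\<exists>c>0. \<forall>p\<ge>1. ennreal c \<le> \<psi> p) \<and>
     (INF p\<in>{p. 1 \<le> p \<and> ereal p < b}. \<psi> p) = 1 \<and>
     b = (SUP p\<in>{p. 1 \<le> p \<and> \<psi> p < \<infinity>}. ereal p)}"

definition GLS_norm ::
    "'a measure \<Rightarrow> ereal \<Rightarrow> (real \<Rightarrow> ennreal) \<Rightarrow> ('a \<Rightarrow> 'k::real_normed_vector) \<Rightarrow> ennreal" where
  "GLS_norm M b \<phi> f = (SUP p\<in>{p. 1 \<le> p \<and> ereal p < b}. Lp_norm M p f / \<phi> p)"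

definition GLS ::
    "'a measure \<Rightarrow> ereal \<Rightarrow> (real \<Rightarrow> ennreal) \<Rightarrow> ('a \<Rightarrow> 'k::real_normed_vector) set" where
  "GLS M b \<phi> = {f \<in> borel_measurable M. GLS_norm M b \<phi> f < \<infinity>}"

definition zeta :: "ereal \<Rightarrow> (real \<Rightarrow> ennreal) \<Rightarrow> real \<Rightarrow> real \<Rightarrow> ennreal" where
  "zeta b \<psi> \<Delta> p =
     (if 1 \<le> p \<and> ereal p < b then ennreal (p powr \<Delta>) * \<psi> p else \<infinity>)"

definition K_const :: "real \<Rightarrow> (real \<Rightarrow> ennreal) \<Rightarrow> ereal \<Rightarrow> ennreal" where
  "K_const \<nu> \<zeta> b =
     (INF q\<in>{q. 1 < q \<and> ereal q < b}. ennreal (q powr \<nu>) * \<zeta> q / ennreal ((q - 1) powr \<nu>))"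


subsection \<open>Exponential Orlicz spaces\<close>

definition young_fenchel :: "(real \<Rightarrow> ennreal) \<Rightarrow> real \<Rightarrow> ereal" where
  "young_fenchel \<phi> u =
     (SUP p\<in>{p. 1 \<le> p \<and> \<phi> p < \<infinity>}. ereal (p * u - p * ln (enn2real (\<phi> p))))"

definition exp_ereal :: "ereal \<Rightarrow> ennreal" where
  "exp_ereal u =
     (if u = \<infinity> then \<infinity> else if u = -\<infinity> then 0 else ennreal (exp (real_of_ereal u)))"

text \<open>
  The transform can be infinite (for instance if \<open>b = \<infinity>\<close> and \<open>\<phi>\<close> is
  bounded), so the Young--Orlicz function is extended valued.
\<close>

definition young_orlicz :: "real \<Rightarrow> (real \<Rightarrow> ennreal) \<Rightarrow> real \<Rightarrow> ennreal" where
  "young_orlicz C0 \<phi> y =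
     (if exp 1 \<le> \<bar>y\<bar> then exp_ereal (young_fenchel \<phi> (ln \<bar>y\<bar>)) else ennreal (C0 * y\<^sup>2))"

text \<open>Luxemburg norm.\<close>

definition orlicz_norm ::
    "'a measure \<Rightarrow> (real \<Rightarrow> ennreal) \<Rightarrow> ('a \<Rightarrow> 'k::real_normed_vector) \<Rightarrow> ennreal" where
  "orlicz_norm M N f = (INF k\<in>{k. 0 < k \<and> (\<integral>\<^sup>+ x. N (norm (f x) / k) \<partial>M) \<le> 1}. ennreal k)"

definition orlicz_space ::
    "'a measure \<Rightarrow> (real \<Rightarrow> ennreal) \<Rightarrow> ('a \<Rightarrow> 'k::real_normed_vector) set" where
  "orlicz_space M N = {f \<in> borel_measurable M. orlicz_norm M N f < \<infinity>}"

end

theory Submission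
  imports Defs
begin

text \<open>
  The bound in the grand Lebesgue norm compares exponents: for \<open>p \<ge> q\<close> the factor
  \<open>p / (p - 1)\<close> is at most \<open>q / (q - 1)\<close>, and for \<open>p < q\<close> the norm of exponent \<open>p\<close> is at
  most that of exponent \<open>q\<close>, while \<open>\<zeta> \<ge> 1\<close>.

  The Orlicz bound cannot be deduced from the grand Lebesgue bound, because the two kinds of
  spaces need not coincide (for instance when \<open>b < \<infinity>\<close>). What makes it true is that the
  supremum of \<open>(y / \<psi>(p))\<^sup>p\<close> over finitely many \<open>p\<close> can be replaced by a sum of powers of
  \<open>y\<close>, to which moment bounds apply term by term. Let \<open>v(p) = p ln \<psi>(p)\<close>, with largest convex
  minorant \<open>w\<close>. From any finite set of exponents one selects a subset \<open>Y\<close> such that every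
  exponent of the set lies between two elements of \<open>Y\<close> with ratio at most 2, at most 1 below
  the chord of \<open>w\<close>, while the terms \<open>exp (q u - w(q))\<close>, \<open>q \<in> Y\<close>, decay geometrically away from
  the largest one (after a shift of \<open>u\<close>). Covering bounds \<open>M\<^sub>\<zeta>\<close> by the sum over \<open>Y\<close>,
  separation bounds the sum by \<open>M\<^sub>\<psi>\<close>, and no constant depends on the finite set, so monotone
  convergence applies.
\<close>

subsection \<open>Sparse sets of exponents\<close>

text \<open>\<open>q - p\<close> times the height at \<open>r\<close> of the chord of \<open>w\<close> over \<open>[p, q]\<close> above \<open>w\<close>.\<close>

definition excess :: "(real \<Rightarrow> real) \<Rightarrow> real \<Rightarrow> real \<Rightarrow> real \<Rightarrow> real" where
  "excess w p r q = w p * (q - r) + w q * (r - p) - w r * (q - p)"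

definition chord_convex :: "(real \<Rightarrow> real) \<Rightarrow> real set \<Rightarrow> bool" where
  "chord_convex w I \<longleftrightarrow>
     (\<forall>p\<in>I. \<forall>r\<in>I. \<forall>q\<in>I. p \<le> r \<longrightarrow> r \<le> q \<longrightarrow> 0 \<le> excess w p r q)"

lemma chord_convexD:
  "\<lbrakk>chord_convex w I; p \<in> I; r \<in> I; q \<in> I; p \<le> r; r \<le> q\<rbrakk> \<Longrightarrow> 0 \<le> excess w p r q"
  by (simp add: chord_convex_def)

text \<open>The witness \<open>w\<close> is the upper envelope of the affine functions that lie
  below \<open>v\<close> on \<open>I\<close>, hence convex. A bound
  \<open>q * u - v q \<le> s\<close> on \<open>I\<close> says that the line of slope
  \<open>u\<close> and intercept \<open>- s\<close> is one of these functions, so passing from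
  \<open>v\<close> to \<open>w\<close> costs nothing in Young-Fenchel bounds. Nonnegativity of
  \<open>v\<close> puts the zero function into the family.\<close>

lemma affine_minorants_sup:
  fixes v :: "real \<Rightarrow> real"
  assumes v: "\<forall>p\<in>I. 0 \<le> v p"
  shows "\<exists>w. (\<forall>p\<in>I. w p \<le> v p) \<and> chord_convex w I \<and>
    (\<forall>u s. (\<forall>q\<in>I. q * u - v q \<le> s) \<longrightarrow> (\<forall>r\<in>I. r * u - w r \<le> s))"
proof -
  define L where "L = {(a, c). \<forall>q\<in>I. a * q + c \<le> v q}"
  define w where "w r = (SUP (a, c)\<in>L. a * r + c)" for r
  have ne: "L \<noteq> {}" using v by (auto simp: L_def intro!: exI[of _ 0])
  have bdd: "bdd_above ((\<lambda>(a, c). a * r + c) ` L)" if "r \<in> I" for r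
    using that by (auto simp: L_def intro!: bdd_aboveI[of _ "v r"])
  have low: "a * r + c \<le> w r" if "r \<in> I" "(a, c) \<in> L" for a c r
    unfolding w_def using cSUP_upper[OF that(2) bdd[OF that(1)]] by simp
  show ?thesis
    unfolding chord_convex_def
  proof (intro exI[of _ w] conjI ballI allI impI)
    fix p assume p: "p \<in> I"
    show "w p \<le> v p"
      unfolding w_def by (rule cSUP_least[OF ne]) (use p in \<open>auto simp: L_def\<close>)
  next
    fix p r q assume I: "p \<in> I" "r \<in> I" "q \<in> I" and le: "p \<le> r" "r \<le> q"
    show "0 \<le> excess w p r q"
    proof (cases "p = q")
      case True
      then show ?thesis using le by (simp add: excess_def)
    next
      case False
      then have pq: "q - p > 0" using le by simp
      have "w r \<le> (w p * (q - r) + w q * (r - p)) / (q - p)"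
        unfolding w_def[of r]
      proof (rule cSUP_least[OF ne], clarify)
        fix a c assume ac: "(a, c) \<in> L"
        have "(a * p + c) * (q - r) \<le> w p * (q - r)" "(a * q + c) * (r - p) \<le> w q * (r - p)"
          using low[OF I(1) ac] low[OF I(3) ac] le by (auto intro!: mult_right_mono)
        moreover have "(a * r + c) * (q - p) = (a * p + c) * (q - r) + (a * q + c) * (r - p)"
          by (simp add: algebra_simps)
        ultimately show "a * r + c \<le> (w p * (q - r) + w q * (r - p)) / (q - p)"
          using pq by (simp add: pos_le_divide_eq)
      qed
      then show ?thesis using pq by (simp add: excess_def pos_le_divide_eq)
    qed
  next
    fix u s r assume "\<forall>q\<in>I. q * u - v q \<le> s" and "r \<in> I"
    then have "(u, - s) \<in> L" by (fastforce simp: L_def algebra_simps)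
    from low[OF \<open>r \<in> I\<close> this] show "r * u - w r \<le> s" by (simp add: algebra_simps)
  qed
qed

text \<open>Concavity of \<open>ln\<close>: the tangent at \<open>r\<close> lies above both
  endpoints, and the weights make its increments cancel.\<close>

lemma excess_ln_nonpos:
  fixes p r q :: real
  assumes "0 < p" "p \<le> r" "r \<le> q"
  shows "excess ln p r q \<le> 0"
proof -
  have r: "0 < r" "0 < q" using assms by auto
  have "ln p - ln r \<le> (p - r) / r" "ln q - ln r \<le> (q - r) / r"
    using ln_le_minus_one[of "p / r"] ln_le_minus_one[of "q / r"] assms(1) r
    by (simp_all add: ln_div diff_divide_distrib)
  then have "(q - r) * (ln p - ln r) + (r - p) * (ln q - ln r)
      \<le> (q - r) * ((p - r) / r) + (r - p) * ((q - r) / r)"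
    using assms by (intro add_mono mult_left_mono) auto
  also have "\<dots> = 0" using r by (simp add: field_simps)
  finally show ?thesis by (simp add: excess_def algebra_simps)
qed

text \<open>For \<open>q \<ge> 2 p\<close> the squared midpoint is at least
  \<open>9/8 * p * q\<close>, with equality at \<open>q = 2 p\<close>. Hence at the midpoint the
  chord of \<open>ln\<close> lies at least \<open>ln (9/8) / 2 \<ge> 1/18\<close> below the graph,
  and the factor 20 lifts this to at least 1.\<close>

lemma excess_ln_midpoint:
  fixes p q :: real
  assumes "0 < p" "2 * p \<le> q"
  shows "20 * excess ln p ((p + q) / 2) q \<le> - (q - p)"
proof -
  let ?m = "(p + q) / 2"
  have q: "0 < q" "p < q" using assms by auto
  have "0 \<le> (q - 2 * p) * (2 * q - p)" using assms by (intro mult_nonneg_nonneg) auto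
  then have "9 / 8 * (p * q) \<le> ?m\<^sup>2" by (simp add: power2_eq_square field_simps)
  then have "ln (9 / 8 * (p * q)) \<le> ln (?m\<^sup>2)" using assms q by (intro ln_mono) auto
  then have "ln (9 / 8) + ln p + ln q \<le> 2 * ln ?m"
    using assms q ln_mult[of "9 / 8" "p * q"] ln_mult[of p q] ln_realpow[of ?m 2] by auto
  moreover have "1 / 9 \<le> ln (9 / 8 :: real)"
    using ln_le_minus_one[of "8 / 9 :: real"] by (simp add: ln_div)
  ultimately have "ln p + ln q - 2 * ln ?m \<le> - (1 / 9)" by linarith
  then have "(10 * (q - p)) * (ln p + ln q - 2 * ln ?m) \<le> (10 * (q - p)) * (- (1 / 9))"
    using q by (intro mult_left_mono) auto
  moreover have "20 * excess ln p ?m q = (10 * (q - p)) * (ln p + ln q - 2 * ln ?m)"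
    by (simp add: excess_def algebra_simps add_divide_distrib diff_divide_distrib)
  ultimately show ?thesis using q by (simp add: field_simps)
qed

text \<open>Moving an endpoint towards \<open>r\<close> lowers the chord of a convex function at
  \<open>r\<close>. The bounds are relative to the width: \<open>excess w p r q \<le> q - p\<close>
  means that the chord is at most 1 above \<open>w\<close>. The opening identity expresses the
  lowering exactly, through the excess at \<open>t\<close>.\<close>

lemma excess_shrink_left:
  assumes "0 \<le> excess w p t q" "p \<le> t" "t \<le> r" "r \<le> q" "excess w p r q \<le> q - p" "p < q"
  shows "excess w t r q \<le> q - t"
proof -
  have "(q - p) * excess w t r q + (q - r) * excess w p t q = (q - t) * excess w p r q"
    by (simp add: excess_def algebra_simps)
  also have "\<dots> \<le> (q - t) * (q - p)"
    using assms by (intro mult_left_mono) auto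
  also have "\<dots> = (q - p) * (q - t)" by (rule mult.commute)
  finally have "(q - p) * excess w t r q + (q - r) * excess w p t q \<le> (q - p) * (q - t)" .
  moreover have "0 \<le> (q - r) * excess w p t q" using assms by simp
  ultimately have "(q - p) * excess w t r q \<le> (q - p) * (q - t)" by linarith
  then show ?thesis using assms by simp
qed

text \<open>Mirror image of \<open>excess_shrink_left\<close>.\<close>

lemma excess_shrink_right:
  assumes "0 \<le> excess w p t q" "p \<le> r" "r \<le> t" "t \<le> q" "excess w p r q \<le> q - p" "p < q"
  shows "excess w p r t \<le> t - p"
proof -
  have "(q - p) * excess w p r t + (r - p) * excess w p t q = (t - p) * excess w p r q"
    by (simp add: excess_def algebra_simps)
  also have "\<dots> \<le> (t - p) * (q - p)"
    using assms by (intro mult_left_mono) auto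
  also have "\<dots> = (q - p) * (t - p)" by (rule mult.commute)
  finally have "(q - p) * excess w p r t + (r - p) * excess w p t q \<le> (q - p) * (t - p)" .
  moreover have "0 \<le> (r - p) * excess w p t q" using assms by simp
  ultimately have "(q - p) * excess w p r t \<le> (q - p) * (t - p)" by linarith
  then show ?thesis using assms by simp
qed

lemma sparse_subset:
  fixes w :: "real \<Rightarrow> real"
  assumes "finite X" "X \<subseteq> I" and pos: "\<forall>p\<in>I. 0 < p"
    and convI: "chord_convex w I"
  shows "\<exists>Y\<subseteq>X.
    (\<forall>r\<in>X. \<exists>p\<in>Y. \<exists>q\<in>Y. p \<le> r \<and> r \<le> q \<and> q \<le> 2 * p \<and> excess w p r q \<le> q - p) \<and>
    (\<forall>p\<in>Y. \<forall>t\<in>Y. \<forall>q\<in>Y. p < t \<longrightarrow> t < q \<longrightarrow> q \<le> 2 * p \<longrightarrow>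
      (\<exists>r\<in>X. p < r \<and> r < q \<and> q - p < excess w p r q))"
proof -
  note conv = chord_convexD[OF convI]
  \<comment> \<open>Choose \<open>Y\<close> of least cardinality with the covering property: a middle point \<open>t\<close> of three
    could be dropped if the chord over its two companions were close enough to \<open>w\<close>.\<close>
  define C where "C Y r \<longleftrightarrow>
    (\<exists>p\<in>Y. \<exists>q\<in>Y. p \<le> r \<and> r \<le> q \<and> q \<le> 2 * p \<and> excess w p r q \<le> q - p)" for Y r
  define P where "P Y \<longleftrightarrow> Y \<subseteq> X \<and> (\<forall>r\<in>X. C Y r)" for Y
  have "C X r" if "r \<in> X" for r
    using that pos assms(2) unfolding C_def
    by (intro bexI[of _ r]) (auto simp: excess_def less_imp_le subset_iff)
  then have "P X" by (auto simp: P_def)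
  then obtain Y where Y: "P Y" and min: "\<And>Y'. P Y' \<Longrightarrow> card Y \<le> card Y'"
    using ex_has_least_nat[of P X card] by blast
  have YX: "Y \<subseteq> X" using Y by (simp add: P_def)
  show ?thesis
  proof (intro exI[of _ Y] conjI ballI impI)
    show "Y \<subseteq> X" by fact
    show "\<exists>p\<in>Y. \<exists>q\<in>Y. p \<le> r \<and> r \<le> q \<and> q \<le> 2 * p \<and> excess w p r q \<le> q - p"
      if "r \<in> X" for r
      using Y that by (simp add: P_def C_def)
  next
    fix p t q assume *: "p \<in> Y" "t \<in> Y" "q \<in> Y" "p < t" "t < q" "q \<le> 2 * p"
    show "\<exists>r\<in>X. p < r \<and> r < q \<and> q - p < excess w p r q"
    proof (rule ccontr)
      assume "\<not> ?thesis"
      then have small: "excess w p r q \<le> q - p" if "r \<in> X" "p \<le> r" "r \<le> q" for r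
        using that * by (cases "r = p \<or> r = q") (auto simp: excess_def not_less)
      \<comment> \<open>Points of \<open>[p, q]\<close> are served by \<open>p\<close> and
        \<open>q\<close>. A point \<open>r < p\<close> whose cover ends at \<open>t\<close> can end
        at \<open>p\<close> instead, and a point \<open>r > q\<close> whose cover starts at
        \<open>t\<close> can start at \<open>q\<close>: the interval shrinks, so neither the ratio
        nor the normalised excess grows.\<close>
      have "C (Y - {t}) r" if r: "r \<in> X" for r
      proof (cases "p \<le> r \<and> r \<le> q")
        case True
        then show ?thesis using small[OF r] * unfolding C_def
          by (intro bexI[of _ p] bexI[of _ q]) auto
      next
        case False
        obtain p' q' where pq: "p' \<in> Y" "q' \<in> Y" "p' \<le> r" "r \<le> q'" "q' \<le> 2 * p'"
            "excess w p' r q' \<le> q' - p'"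
          using Y r by (auto simp: P_def C_def)
        have I: "p' \<in> I" "q' \<in> I" "r \<in> I" "p \<in> I" "q \<in> I"
          using pq * r YX assms(2) by auto
        consider "r < p" | "q < r" using False by linarith
        then show ?thesis
        proof cases
          case 1
          have "p' \<noteq> t" using 1 pq * by auto
          show ?thesis
          proof (cases "q' = t")
            case False
            then show ?thesis using pq \<open>p' \<noteq> t\<close> unfolding C_def by blast
          next
            case True
            have "excess w p' r p \<le> p - p'"
              by (rule excess_shrink_right[of _ _ _ q']) (use 1 pq * I True conv in auto)
            then show ?thesis using pq 1 * True \<open>p' \<noteq> t\<close> unfolding C_def
              by (intro bexI[of _ p'] bexI[of _ p]) auto
          qed
        next
          case 2
          have "q' \<noteq> t" using 2 pq * by auto
          show ?thesis
          proof (cases "p' = t")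
            case False
            then show ?thesis using pq \<open>q' \<noteq> t\<close> unfolding C_def by blast
          next
            case True
            have "excess w q r q' \<le> q' - q"
              by (rule excess_shrink_left[of _ p']) (use 2 pq * I True conv in auto)
            then show ?thesis using pq 2 * True \<open>q' \<noteq> t\<close> unfolding C_def
              by (intro bexI[of _ q] bexI[of _ q']) auto
          qed
        qed
      qed
      then have "P (Y - {t})" using YX by (auto simp: P_def)
      from min[OF this] show False
        using * finite_subset[OF YX \<open>finite X\<close>]
        by (metis card_Diff1_less not_less)
    qed
  qed
qed

text \<open>The gap of 1 is only assumed across a third element, so two terms are peeled off at a
  time. The terms at the two largest indices contribute at most \<open>2 * exp s\<close>; the others
  satisfy the hypotheses with \<open>s - 1\<close>, and
  \<open>4 * exp (s - 1) \<le> 2 * exp s\<close> closes the induction.\<close>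

lemma sum_exp_growing:
  fixes a :: "real \<Rightarrow> real"
  assumes "finite Y"
    and "\<And>p t q. \<lbrakk>p \<in> Y; t \<in> Y; q \<in> Y; p < t; t < q\<rbrakk> \<Longrightarrow> a p + 1 \<le> a q"
    and "\<And>q. q \<in> Y \<Longrightarrow> a q \<le> s"
  shows "(\<Sum>q\<in>Y. exp (a q)) \<le> 4 * exp s"
  using assms
proof (induction "card Y" arbitrary: Y s rule: less_induct)
  case less
  show ?case
  proof (cases "card Y \<le> 2")
    case True
    have "(\<Sum>q\<in>Y. exp (a q)) \<le> of_nat (card Y) * exp s"
      using less.prems by (intro sum_bounded_above) auto
    also have "\<dots> \<le> 4 * exp s" using True by (intro mult_right_mono) auto
    finally show ?thesis .
  next
    case False
    define z where "z = Max Y"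
    define z' where "z' = Max (Y - {z})"
    have Yne: "Y \<noteq> {}" using False by auto
    then have z: "z \<in> Y" "\<And>q. q \<in> Y \<Longrightarrow> q \<le> z"
      using less.prems(1) by (auto simp: z_def)
    have "card (Y - {z}) \<noteq> 0" using False z less.prems(1) by simp
    then have "Y - {z} \<noteq> {}" by (metis card.empty)
    then have "z' \<in> Y - {z}" and z'2: "\<And>q. q \<in> Y - {z} \<Longrightarrow> q \<le> z'"
      using less.prems(1) Max_in[of "Y - {z}"] by (auto simp: z'_def)
    then have z': "z' \<in> Y" "z' \<noteq> z" by auto
    let ?Y = "Y - {z, z'}"
    have below: "a q \<le> s - 1" if "q \<in> ?Y" for q
    proof -
      have "q < z'" "z' < z" using that z z' z'2[of q] by (auto simp: less_le)
      then have "a q + 1 \<le> a z" using that z(1) z'(1) by (intro less.prems(2)[of q z' z]) auto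
      then show ?thesis using less.prems(3)[OF z(1)] by linarith
    qed
    have "(\<Sum>q\<in>?Y. exp (a q)) \<le> 4 * exp (s - 1)"
    proof (rule less.hyps)
      show "card ?Y < card Y" using z z' less.prems(1) by (intro psubset_card_mono) auto
    qed (use less.prems below in auto)
    also have "\<dots> \<le> 2 * exp s"
    proof -
      have "2 * exp (s - 1) \<le> exp 1 * exp (s - 1)"
        using exp_ge_add_one_self[of 1] by (intro mult_right_mono) auto
      then show ?thesis by (simp flip: exp_add)
    qed
    finally have "(\<Sum>q\<in>?Y. exp (a q)) \<le> 2 * exp s" .
    moreover have "(\<Sum>q\<in>Y. exp (a q)) = exp (a z) + exp (a z') + (\<Sum>q\<in>?Y. exp (a q))"
      using z z' less.prems(1)
      by (subst sum.remove[of Y z]; simp; subst sum.remove[of "Y - {z}" z'])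
        (auto simp: Diff_insert2[symmetric] insert_commute)
    moreover have "exp (a z) \<le> exp s" "exp (a z') \<le> exp s"
      using less.prems(3) z z' by auto
    ultimately show ?thesis by linarith
  qed
qed

text \<open>The exponent \<open>q * u - W q\<close> is concave in \<open>q\<close>, so on
  \<open>Y\<close> it rises up to a maximiser and falls after it. On either side the chord gap
  becomes growth by 1 across every three elements, and \<open>sum_exp_growing\<close> applies: 4
  from each side and 1 from the maximiser give 9.\<close>

lemma sum_exp_separated:
  fixes W :: "real \<Rightarrow> real"
  assumes "finite Y" "Y \<subseteq> I"
    and convI: "chord_convex W I"
    and sep: "\<And>p t q. \<lbrakk>p \<in> Y; t \<in> Y; q \<in> Y; p < t; t < q\<rbrakk> \<Longrightarrow>
        \<exists>r\<in>I. p < r \<and> r < q \<and> q - p \<le> excess W p r q"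
    and le: "\<And>q. q \<in> Y \<Longrightarrow> q * u - W q \<le> s"
  shows "(\<Sum>q\<in>Y. exp (q * u - W q)) \<le> 9 * exp s"
proof (cases "Y = {}")
  case False
  note conv = chord_convexD[OF convI]
  define a where "a q = q * u - W q" for q
  have ex: "excess a p r q = - excess W p r q" for p r q
    by (simp add: excess_def a_def algebra_simps)
  obtain x where x: "x \<in> Y" "\<And>q. q \<in> Y \<Longrightarrow> a q \<le> a x"
    using Max_in[of "a ` Y"] Max_ge[of "a ` Y"] assms(1) False by fastforce
  have xI: "x \<in> I" using x assms by auto
  \<comment> \<open>\<open>x\<close> maximises \<open>a\<close> over \<open>Y\<close> only, hence
    the premise \<open>a q \<le> a x\<close>; concavity then forces \<open>a\<close> to be no larger
    before \<open>q\<close>.\<close>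
  have up: "a p \<le> a q" if "p \<in> I" "q \<in> I" "p \<le> q" "q < x" "a q \<le> a x" for p q
  proof -
    have "a p * (x - q) + a x * (q - p) \<le> a q * (x - p)"
      using conv[of p q x] ex[of p q x] that xI by (simp add: excess_def)
    moreover have "a q * (q - p) \<le> a x * (q - p)" using that by (intro mult_right_mono) auto
    ultimately have "a p * (x - q) \<le> a q * (x - q)" by (simp add: algebra_simps)
    then show ?thesis using that by simp
  qed
  have dn: "a q \<le> a p" if "p \<in> I" "q \<in> I" "p \<le> q" "x < p" "a p \<le> a x" for p q
  proof -
    have "a x * (q - p) + a q * (p - x) \<le> a p * (q - x)"
      using conv[of x p q] ex[of x p q] that xI by (simp add: excess_def)
    moreover have "a p * (q - p) \<le> a x * (q - p)" using that by (intro mult_right_mono) auto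
    ultimately have "a q * (p - x) \<le> a p * (p - x)" by (simp add: algebra_simps)
    then show ?thesis using that by simp
  qed
  define L where "L = {q\<in>Y. q < x}"
  define R where "R = {q\<in>Y. x < q}"
  have "(\<Sum>q\<in>L. exp (a q)) \<le> 4 * exp s"
  proof (rule sum_exp_growing)
    fix p t q assume *: "p \<in> L" "t \<in> L" "q \<in> L" "p < t" "t < q"
    then obtain r where r: "r \<in> I" "p < r" "r < q" "q - p \<le> excess W p r q"
      using sep[of p t q] by (auto simp: L_def)
    have pq: "p \<in> I" "q \<in> I" "q < x" "a q \<le> a x" using * x assms by (auto simp: L_def)
    \<comment> \<open>The chord of \<open>a\<close> over \<open>[p, q]\<close> never drops below
      \<open>a p\<close>, and \<open>a r\<close> exceeds it by at least 1; monotonicity carries this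
      from \<open>r\<close> to \<open>q\<close>.\<close>
    have "a p * (r - p) \<le> a q * (r - p)" using up[of p q] pq r by (intro mult_right_mono) auto
    then have "(a p + 1) * (q - p) \<le> a r * (q - p)"
      using ex[of p r q] r(4) by (simp add: excess_def algebra_simps)
    then have "a p + 1 \<le> a r" using r by simp
    also have "\<dots> \<le> a q" using up[of r q] pq r by auto
    finally show "a p + 1 \<le> a q" .
  qed (use assms in \<open>auto simp: L_def a_def\<close>)
  \<comment> \<open>Reflecting the indices turns the decay to the right of \<open>x\<close> into the
    growth that \<open>sum_exp_growing\<close> asks for.\<close>
  moreover have "(\<Sum>q\<in>uminus ` R. exp ((a \<circ> uminus) q)) \<le> 4 * exp s"
  proof (rule sum_exp_growing)
    fix p' t' q' assume "p' \<in> uminus ` R" "t' \<in> uminus ` R" "q' \<in> uminus ` R" "p' < t'" "t' < q'"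
    then obtain p t q where *: "p \<in> R" "t \<in> R" "q \<in> R" "p < t" "t < q"
        and eq: "p' = - q" "q' = - p"
      by auto
    then obtain r where r: "r \<in> I" "p < r" "r < q" "q - p \<le> excess W p r q"
      using sep[of p t q] by (auto simp: R_def)
    have pq: "p \<in> I" "q \<in> I" "x < p" "a p \<le> a x" using * x assms by (auto simp: R_def)
    have "a q * (q - r) \<le> a p * (q - r)" using dn[of p q] pq r by (intro mult_right_mono) auto
    then have "(a q + 1) * (q - p) \<le> a r * (q - p)"
      using ex[of p r q] r(4) by (simp add: excess_def algebra_simps)
    then have "a q + 1 \<le> a r" using r by simp
    also have "\<dots> \<le> a p" using dn[of p r] pq r by auto
    finally show "(a \<circ> uminus) p' + 1 \<le> (a \<circ> uminus) q'" by (simp add: eq)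
  qed (use assms in \<open>auto simp: R_def a_def\<close>)
  then have "(\<Sum>q\<in>R. exp (a q)) \<le> 4 * exp s"
    by (simp add: sum.reindex)
  moreover have "exp (a x) \<le> exp s" using le[OF x(1)] by (simp add: a_def)
  moreover have "(\<Sum>q\<in>Y. exp (a q)) = (\<Sum>q\<in>L. exp (a q)) + exp (a x) + (\<Sum>q\<in>R. exp (a q))"
  proof -
    have Y: "Y = (L \<union> {x}) \<union> R" using x by (auto simp: L_def R_def)
    have "finite L" "finite R" using assms by (auto simp: L_def R_def)
    then show ?thesis
      by (subst Y, subst sum.union_disjoint) (auto simp: L_def R_def)
  qed
  ultimately have "(\<Sum>q\<in>Y. exp (a q)) \<le> 9 * exp s" by linarith
  then show ?thesis by (simp add: a_def)
qed simp

text \<open>The term \<open>\<Delta> * (q * ln q)\<close> stays in the covering sum because the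
  moment bounds of the operator will supply exactly the reciprocal factor; the second bound is
  therefore stated without it. Neither constant refers to \<open>X\<close>, which lets the finite
  set grow afterwards.\<close>

lemma discretisation:
  fixes v :: "real \<Rightarrow> real"
  assumes v: "\<forall>p\<in>I. 0 \<le> v p" and ge1: "\<forall>p\<in>I. 1 \<le> p"
    and ivl: "is_interval I"
    and X: "finite X" "X \<subseteq> I" and \<Delta>: "0 \<le> \<Delta>"
  shows "\<exists>Y w. Y \<subseteq> X \<and>
    (\<forall>r\<in>X. \<forall>u. exp (r * (u - \<Delta> * ln 2) - v r - \<Delta> * (r * ln r))
        \<le> exp 1 * (\<Sum>q\<in>Y. exp (q * u - w q - \<Delta> * (q * ln q)))) \<and>
    (\<forall>u s. (\<forall>p\<in>I. p * (u + 20) - v p \<le> s) \<longrightarrow>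
        (\<Sum>q\<in>Y. exp (q * u - w q)) \<le> 9 * exp s)"
proof -
  obtain w where w: "\<forall>p\<in>I. w p \<le> v p" and convI: "chord_convex w I"
    and legendre: "\<forall>u s. (\<forall>q\<in>I. q * u - v q \<le> s) \<longrightarrow> (\<forall>r\<in>I. r * u - w r \<le> s)"
    using affine_minorants_sup[OF v] by blast
  note conv = chord_convexD[OF convI]
  have pos: "\<forall>p\<in>I. 0 < p" using ge1 by force
  obtain Y where Y: "Y \<subseteq> X"
    and cover: "\<forall>r\<in>X. \<exists>p\<in>Y. \<exists>q\<in>Y.
        p \<le> r \<and> r \<le> q \<and> q \<le> 2 * p \<and> excess w p r q \<le> q - p"
    and sep: "\<forall>p\<in>Y. \<forall>t\<in>Y. \<forall>q\<in>Y. p < t \<longrightarrow> t < q \<longrightarrow> q \<le> 2 * p \<longrightarrow>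
        (\<exists>r\<in>X. p < r \<and> r < q \<and> q - p < excess w p r q)"
    using sparse_subset[OF X pos convI] by blast
  have finY: "finite Y" and YI: "Y \<subseteq> I" using Y X finite_subset by auto
  show ?thesis
  proof (intro exI[of _ Y] exI[of _ w] conjI ballI allI impI)
    show "Y \<subseteq> X" by fact
  next
    fix r u assume r: "r \<in> X"
    then have rI: "r \<in> I" using X by auto
    define a where "a q = q * u - w q - \<Delta> * (q * ln q)" for q
    obtain p q where pq: "p \<in> Y" "q \<in> Y" "p \<le> r" "r \<le> q" "q \<le> 2 * p" "excess w p r q \<le> q - p"
      using cover r by blast
    have pqI: "p \<in> I" "q \<in> I" using pq YI by auto
    define z where "z = r * (u - \<Delta> * ln 2) - v r - \<Delta> * (r * ln r)"
    \<comment> \<open>Times \<open>q - p\<close>, \<open>z\<close> is bounded by a weighted mean of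
      \<open>a p\<close> and \<open>a q\<close> plus the allowed excess. A degenerate cover has no
      width to divide by and is settled directly.\<close>
    have "z \<le> 1 + max (a p) (a q)"
    proof (cases "p = q")
      case True
      then have "p = r" "q = r" using pq by auto
      moreover have "0 \<le> \<Delta> * (r * ln 2)" using \<Delta> pos rI by auto
      ultimately show ?thesis using bspec[OF w rI] by (simp add: a_def z_def algebra_simps)
    next
      case False
      then have d: "0 < q - p" using pq by simp
      \<comment> \<open>Here the ratio bound enters: \<open>q \<le> 2 p \<le> 2 r\<close> bounds the
        chord of \<open>q * ln q\<close> at \<open>r\<close> by \<open>r * ln r + r * ln 2\<close>,
        and the shift \<open>\<Delta> * ln 2\<close> of \<open>u\<close> pays for the last
        term.\<close>
      have "q * ln q * (r - p) + p * ln p * (q - r) \<le> q * ln q * (r - p) + p * ln q * (q - r)"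
        using pq pos pqI by (intro add_left_mono mult_right_mono mult_left_mono) auto
      also have "\<dots> = r * ln q * (q - p)" by (simp add: algebra_simps)
      also have "\<dots> \<le> r * ln (2 * r) * (q - p)"
        using pq d pos rI pqI(2) by (intro mult_right_mono mult_left_mono ln_mono) auto
      also have "\<dots> = (r * ln r + r * ln 2) * (q - p)"
        using pos rI by (simp add: ln_mult algebra_simps)
      finally have "\<Delta> * (q * ln q * (r - p) + p * ln p * (q - r))
          \<le> \<Delta> * ((r * ln r + r * ln 2) * (q - p))"
        using \<Delta> by (rule mult_left_mono)
      moreover have "w r * (q - p) \<le> v r * (q - p)" using w rI d by simp
      moreover have "w p * (q - r) + w q * (r - p) \<le> w r * (q - p) + (q - p)"
        using pq(6) by (simp add: excess_def)
      ultimately have "z * (q - p) \<le> a p * (q - r) + a q * (r - p) + (q - p)"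
        by (simp add: a_def z_def algebra_simps)
      also have "\<dots> \<le> max (a p) (a q) * (q - r) + max (a p) (a q) * (r - p) + (q - p)"
        using pq by (intro add_mono mult_right_mono) auto
      also have "\<dots> = (1 + max (a p) (a q)) * (q - p)" by (simp add: algebra_simps)
      finally show ?thesis using d by simp
    qed
    then have "exp z \<le> exp 1 * exp (max (a p) (a q))" by (simp flip: exp_add)
    also have "exp (max (a p) (a q)) \<le> (\<Sum>q\<in>Y. exp (a q))"
      using pq finY by (auto simp: max_def intro!: member_le_sum)
    finally show "exp (r * (u - \<Delta> * ln 2) - v r - \<Delta> * (r * ln r))
        \<le> exp 1 * (\<Sum>q\<in>Y. exp (q * u - w q - \<Delta> * (q * ln q)))"
      by (simp add: a_def z_def)
  next
    fix u s assume s: "\<forall>p\<in>I. p * (u + 20) - v p \<le> s"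
    \<comment> \<open>The convex term \<open>- 20 ln p\<close> produces a chord gap of at least 1 as soon as the exponent
      doubles, at the price of replacing \<open>u\<close> by \<open>u + 20\<close>.\<close>
    define W where "W p = w p - 20 * ln p" for p
    have exW: "excess W p r q = excess w p r q - 20 * excess ln p r q" for p r q
      by (simp add: excess_def W_def algebra_simps)
    have "(\<Sum>q\<in>Y. exp (q * u - w q)) \<le> (\<Sum>q\<in>Y. exp (q * u - W q))"
      using YI ge1 by (intro sum_mono) (auto simp: W_def)
    also have "\<dots> \<le> 9 * exp s"
    proof (rule sum_exp_separated[OF finY YI])
      show "chord_convex W I"
        unfolding chord_convex_def
      proof (intro ballI impI)
        fix p r q assume "p \<in> I" "r \<in> I" "q \<in> I" "p \<le> r" "r \<le> q"
        then show "0 \<le> excess W p r q"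
          using conv[of p r q] excess_ln_nonpos[of p r q] pos by (simp add: exW)
      qed
    next
      fix p t q assume *: "p \<in> Y" "t \<in> Y" "q \<in> Y" "p < t" "t < q"
      have pqI: "p \<in> I" "q \<in> I" using * YI by auto
      show "\<exists>r\<in>I. p < r \<and> r < q \<and> q - p \<le> excess W p r q"
      proof (cases "q \<le> 2 * p")
        case True
        then obtain r where "r \<in> X" "p < r" "r < q" "q - p < excess w p r q" using sep * by blast
        then show ?thesis using excess_ln_nonpos[of p r q] pos pqI(1) X
          by (intro bexI[of _ r]) (auto simp: exW)
      next
        case False
        \<comment> \<open>Sparseness is silent about triples of ratio above 2. There the correction
          by \<open>ln\<close> gives the gap at the midpoint, which lies in the interval
          \<open>I\<close> though perhaps not in \<open>X\<close>.\<close>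
        let ?m = "(p + q) / 2"
        have "?m \<in> I" using * pqI by (auto intro!: mem_is_interval_1_I[OF ivl pqI])
        then show ?thesis
          using excess_ln_midpoint[of p q] conv[of p ?m q] pqI pos False *
          by (intro bexI[of _ ?m]) (auto simp: exW)
      qed
    next
      fix q assume "q \<in> Y"
      then have q: "q \<in> I" using YI by auto
      \<comment> \<open>\<open>20 * ln q \<le> 20 * q\<close> converts the correction into the shift
        of \<open>u\<close>. The bound by \<open>s\<close> is assumed for \<open>v\<close> and
        passes to \<open>w\<close> by the choice of \<open>w\<close>.\<close>
      have "q * u - W q \<le> q * (u + 20) - w q"
        using ln_le_minus_one[of q] pos q by (simp add: W_def algebra_simps)
      also have "\<dots> \<le> s" using legendre s q by simp
      finally show "q * u - W q \<le> s" .
    qed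
    finally show "(\<Sum>q\<in>Y. exp (q * u - w q)) \<le> 9 * exp s" .
  qed
qed

subsection \<open>Integration of the discretised Young--Orlicz function\<close>

text \<open>Each factor of the scale has its task: \<open>2 powr \<Delta>\<close> is the shift in
  the covering bound, \<open>B\<close> cancels the moment constant, \<open>exp 21\<close> is the
  shift 20 of the total bound plus 1 for the threshold \<open>exp 1\<close>, and
  \<open>\<kappa>\<close> is free to make the integral small.\<close>

lemma nn_integral_finite_max_le:
  fixes F G :: "'a \<Rightarrow> real" and v :: "real \<Rightarrow> real"
  assumes "prob_space M" and F[measurable]: "F \<in> borel_measurable M"
    and G[measurable]: "G \<in> borel_measurable M"
    and F0: "\<forall>x. 0 \<le> F x" and G0: "\<forall>x. 0 \<le> G x"
    and v: "\<forall>p\<in>I. 0 \<le> v p" and ge1: "\<forall>p\<in>I. 1 \<le> p" and "I \<noteq> {}"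
    and ivl: "is_interval I"
    and X: "finite X" "X \<subseteq> I" and \<Delta>: "0 \<le> \<Delta>" and B: "0 < B" and \<kappa>: "1 \<le> \<kappa>"
    and moments: "\<forall>q\<in>I. (\<integral>\<^sup>+x. ennreal (G x powr q) \<partial>M)
        \<le> ennreal (B powr q * exp (\<Delta> * (q * ln q))) * (\<integral>\<^sup>+x. ennreal (F x powr q) \<partial>M)"
    and \<Phi>: "\<forall>p\<in>I. \<forall>y\<ge>exp 1. ennreal (exp (p * ln y - v p)) \<le> \<Phi> y"
    and int\<Phi>: "(\<integral>\<^sup>+x. \<Phi> (F x) \<partial>M) \<le> 1"
  shows "(\<integral>\<^sup>+x. (SUP r\<in>X. ennreal ((G x / (2 powr \<Delta> * B * exp 21 * \<kappa>)) powr r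
      * exp (- v r - \<Delta> * (r * ln r)))) \<partial>M) \<le> ennreal (18 * exp 1 / \<kappa>)"
proof -
  interpret prob_space M by fact
  obtain Y w where YX: "Y \<subseteq> X"
    and cover: "\<forall>r\<in>X. \<forall>u. exp (r * (u - \<Delta> * ln 2) - v r - \<Delta> * (r * ln r))
        \<le> exp 1 * (\<Sum>q\<in>Y. exp (q * u - w q - \<Delta> * (q * ln q)))"
    and total: "\<forall>u s. (\<forall>p\<in>I. p * (u + 20) - v p \<le> s) \<longrightarrow>
        (\<Sum>q\<in>Y. exp (q * u - w q)) \<le> 9 * exp s"
    using discretisation[OF v ge1 ivl X \<Delta>] by blast
  have finY: "finite Y" and YI: "Y \<subseteq> I" using YX X finite_subset by auto
  define T where "T y = (\<Sum>q\<in>Y. (y / exp 21) powr q * exp (- w q))" for y :: real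
  have T_exp: "T y = (\<Sum>q\<in>Y. exp (q * (ln y - 21) - w q))" if "0 < y" for y
    unfolding T_def using that
    by (intro sum.cong refl) (simp add: powr_def ln_div flip: exp_add)
  have T_mono: "T y \<le> T z" if "0 \<le> y" "y \<le> z" for y z
    unfolding T_def
  proof (intro sum_mono mult_right_mono powr_mono2)
    show "0 \<le> q" if "q \<in> Y" for q using that YI ge1 by force
  qed (use that in \<open>auto intro: divide_right_mono\<close>)
  have T0: "0 \<le> T y" for y unfolding T_def by (intro sum_nonneg) auto
  \<comment> \<open>At \<open>y = exp 1\<close> the shifted argument \<open>u + 20\<close>, with
    \<open>u = ln y - 21\<close>, equals 0, so \<open>s = 0\<close> is admissible because
    \<open>v \<ge> 0\<close>; monotonicity covers smaller \<open>y\<close>.\<close>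
  have T_small: "T y \<le> 9" if "0 \<le> y" "y \<le> exp 1" for y
  proof -
    have "T y \<le> T (exp 1)" using that by (rule T_mono)
    also have "\<dots> = (\<Sum>q\<in>Y. exp (q * (- 20) - w q))" by (subst T_exp) auto
    also have "\<dots> \<le> 9 * exp 0" by (rule total[rule_format]) (use v in auto)
    finally show ?thesis by simp
  qed
  \<comment> \<open>Now the shifted argument is \<open>ln y - 1\<close>, below \<open>ln y\<close>,
    so every finite value \<open>t\<close> of \<open>\<Phi> y\<close> provides the admissible bound
    \<open>s = ln t\<close>.\<close>
  have T_large: "ennreal (T y / 9) \<le> \<Phi> y" if y: "exp 1 \<le> y" for y
  proof (cases "\<Phi> y")
    case (real t)
    have y0: "0 < y" using y exp_gt_zero[of 1] by linarith
    have t: "exp (p * ln y - v p) \<le> t" if "p \<in> I" for p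
      using \<Phi> that y real by force
    obtain p0 where "p0 \<in> I" using \<open>I \<noteq> {}\<close> by auto
    then have t0: "0 < t" using t[of p0] by (auto intro: less_le_trans[OF exp_gt_zero])
    have "T y \<le> 9 * exp (ln t)"
      unfolding T_exp[OF y0]
    proof (rule total[rule_format])
      fix p assume p: "p \<in> I"
      have "p * ln y - v p \<le> ln t" using t[OF p] t0 by (metis ln_exp ln_mono exp_gt_zero)
      then show "p * (ln y - 21 + 20) - v p \<le> ln t"
        using bspec[OF ge1 p] by (simp add: algebra_simps)
    qed
    then have "ennreal (T y / 9) \<le> ennreal t" using t0 by (intro ennreal_leI) auto
    then show ?thesis using real by simp
  qed simp
  \<comment> \<open>The regions below and above the threshold \<open>exp 1\<close> contribute at
    most 9 each. Additivity and scaling are applied to \<open>T\<close>, which is measurable;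
    \<open>\<Phi>\<close> enters by monotonicity alone.\<close>
  have intT: "(\<integral>\<^sup>+x. ennreal (T (F x)) \<partial>M) \<le> 18"
  proof -
    have [measurable]: "(\<lambda>x. T (F x)) \<in> borel_measurable M"
      unfolding T_def by measurable
    have "(\<integral>\<^sup>+x. ennreal (T (F x)) \<partial>M)
        \<le> (\<integral>\<^sup>+x. 9 + ennreal (T (F x)) * indicator {x. exp 1 \<le> F x} x \<partial>M)"
    proof (intro nn_integral_mono)
      fix x
      show "ennreal (T (F x)) \<le> 9 + ennreal (T (F x)) * indicator {x. exp 1 \<le> F x} x"
        using ennreal_leI[OF T_small[OF F0[rule_format, of x]]] by (cases "exp 1 \<le> F x") auto
    qed
    also have "\<dots> = 9 + (\<integral>\<^sup>+x. ennreal (T (F x)) * indicator {x. exp 1 \<le> F x} x \<partial>M)"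
      by (subst nn_integral_add) (auto simp: emeasure_space_1)
    also have "(\<integral>\<^sup>+x. ennreal (T (F x)) * indicator {x. exp 1 \<le> F x} x \<partial>M)
        = 9 * (\<integral>\<^sup>+x. ennreal (T (F x) / 9) * indicator {x. exp 1 \<le> F x} x \<partial>M)"
    proof -
      have "ennreal (T (F x)) = 9 * ennreal (T (F x) / 9)" for x
        using T0[of "F x"] by (simp flip: ennreal_numeral ennreal_mult)
      then show ?thesis by (simp add: mult.assoc nn_integral_cmult)
    qed
    also have "(\<integral>\<^sup>+x. ennreal (T (F x) / 9) * indicator {x. exp 1 \<le> F x} x \<partial>M)
        \<le> (\<integral>\<^sup>+x. \<Phi> (F x) \<partial>M)"
      using T_large by (intro nn_integral_mono) (auto simp: indicator_def)
    also have "\<dots> \<le> 1" by (rule int\<Phi>)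
    finally show ?thesis by (simp add: mult_left_mono add_left_mono)
  qed
  \<comment> \<open>\<open>c q\<close> collects the scale and the weights of the covering sum; the
    factor \<open>2 powr \<Delta>\<close> is absent because it is spent on the covering
    shift.\<close>
  define c where "c q = (B * exp 21 * \<kappa>) powr (- q) * exp (- w q - \<Delta> * (q * ln q))" for q
  let ?k = "2 powr \<Delta> * B * exp 21 * \<kappa>"
  have c0: "0 \<le> c q" for q by (simp add: c_def)
  have pt: "(SUP r\<in>X. ennreal ((G x / ?k) powr r * exp (- v r - \<Delta> * (r * ln r))))
      \<le> (\<Sum>q\<in>Y. ennreal (exp 1 * c q) * ennreal (G x powr q))" for x
  proof (rule SUP_least)
    fix r assume r: "r \<in> X"
    show "ennreal ((G x / ?k) powr r * exp (- v r - \<Delta> * (r * ln r)))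
        \<le> (\<Sum>q\<in>Y. ennreal (exp 1 * c q) * ennreal (G x powr q))"
    proof (cases "G x = 0")
      case False
      then have g: "0 < G x" using G0[rule_format, of x] by simp
      define u where "u = ln (G x / (B * exp 21 * \<kappa>))"
      have k: "0 < B * exp 21 * \<kappa>" using B \<kappa> by simp
      have "(G x / ?k) powr r = exp (r * (u - \<Delta> * ln 2))"
        using g B \<kappa> by (simp add: powr_def u_def ln_div ln_mult ln_powr)
      then have "(G x / ?k) powr r * exp (- v r - \<Delta> * (r * ln r))
          = exp (r * (u - \<Delta> * ln 2) - v r - \<Delta> * (r * ln r))"
        by (simp flip: exp_add add: algebra_simps)
      also have "\<dots> \<le> exp 1 * (\<Sum>q\<in>Y. exp (q * u - w q - \<Delta> * (q * ln q)))"
        using cover r by blast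
      also have "\<dots> = (\<Sum>q\<in>Y. (exp 1 * c q) * G x powr q)"
        unfolding sum_distrib_left
      proof (intro sum.cong refl)
        fix q
        have "exp (q * u - w q - \<Delta> * (q * ln q)) = exp (q * u) * exp (- w q - \<Delta> * (q * ln q))"
          by (simp flip: exp_add add: algebra_simps)
        also have "exp (q * u) = (G x / (B * exp 21 * \<kappa>)) powr q"
          using g B \<kappa> by (simp add: powr_def u_def)
        also have "\<dots> = G x powr q * (B * exp 21 * \<kappa>) powr (- q)"
          using g B \<kappa> by (simp add: powr_divide powr_minus field_simps)
        finally show "exp 1 * exp (q * u - w q - \<Delta> * (q * ln q)) = exp 1 * c q * G x powr q"
          by (simp add: c_def)
      qed
      finally have "ennreal ((G x / ?k) powr r * exp (- v r - \<Delta> * (r * ln r)))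
          \<le> ennreal (\<Sum>q\<in>Y. (exp 1 * c q) * G x powr q)"
        by (rule ennreal_leI)
      also have "\<dots> = (\<Sum>q\<in>Y. ennreal (exp 1 * c q) * ennreal (G x powr q))"
        using c0 by (simp add: sum_ennreal[symmetric] ennreal_mult)
      finally show ?thesis .
    qed simp
  qed
  \<comment> \<open>The factors from the moment bound cancel. Besides the weight that
    \<open>T\<close> carries, the scale leaves \<open>\<kappa> powr (- q)\<close>, which is at most
    \<open>1 / \<kappa>\<close> because \<open>q \<ge> 1\<close>.\<close>
  have coeff: "exp 1 * c q * (B powr q * exp (\<Delta> * (q * ln q)))
      \<le> exp 1 / \<kappa> * (exp (- w q) * exp 21 powr (- q))" if q: "q \<in> Y" for q
  proof -
    have q1: "1 \<le> q" using q YI ge1 by auto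
    have "c q * (B powr q * exp (\<Delta> * (q * ln q)))
        = \<kappa> powr (- q) * (exp (- w q) * exp 21 powr (- q))"
      using B \<kappa> by (simp add: c_def powr_mult powr_minus exp_diff field_simps)
    also have "\<dots> \<le> (1 / \<kappa>) * (exp (- w q) * exp 21 powr (- q))"
      using \<kappa> q1 powr_mono[of "- q" "- 1" \<kappa>]
      by (intro mult_right_mono) (auto simp: powr_minus_divide)
    finally have "exp 1 * (c q * (B powr q * exp (\<Delta> * (q * ln q))))
        \<le> exp 1 * ((1 / \<kappa>) * (exp (- w q) * exp 21 powr (- q)))"
      by (intro mult_left_mono) auto
    then show ?thesis by (simp add: mult.assoc)
  qed
  have "(\<integral>\<^sup>+x. (SUP r\<in>X. ennreal ((G x / ?k) powr r * exp (- v r - \<Delta> * (r * ln r)))) \<partial>M)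
      \<le> (\<integral>\<^sup>+x. (\<Sum>q\<in>Y. ennreal (exp 1 * c q) * ennreal (G x powr q)) \<partial>M)"
    by (intro nn_integral_mono pt)
  also have "\<dots> = (\<Sum>q\<in>Y. ennreal (exp 1 * c q) * (\<integral>\<^sup>+x. ennreal (G x powr q) \<partial>M))"
    by (subst nn_integral_sum) (auto simp: nn_integral_cmult)
  also have "\<dots> \<le> (\<Sum>q\<in>Y. ennreal (exp 1 / \<kappa>)
      * (ennreal (exp (- w q) * exp 21 powr (- q)) * (\<integral>\<^sup>+x. ennreal (F x powr q) \<partial>M)))"
  proof (intro sum_mono)
    fix q assume q: "q \<in> Y"
    have "ennreal (exp 1 * c q) * (\<integral>\<^sup>+x. ennreal (G x powr q) \<partial>M)
        \<le> ennreal (exp 1 * c q) * (ennreal (B powr q * exp (\<Delta> * (q * ln q)))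
          * (\<integral>\<^sup>+x. ennreal (F x powr q) \<partial>M))"
      using moments q YI by (intro mult_left_mono) auto
    also have "\<dots> = ennreal (exp 1 * c q * (B powr q * exp (\<Delta> * (q * ln q))))
        * (\<integral>\<^sup>+x. ennreal (F x powr q) \<partial>M)"
      using c0[of q] by (simp add: ennreal_mult mult.assoc)
    also have "\<dots> \<le> ennreal (exp 1 / \<kappa> * (exp (- w q) * exp 21 powr (- q)))
        * (\<integral>\<^sup>+x. ennreal (F x powr q) \<partial>M)"
      using coeff[OF q] by (intro mult_right_mono ennreal_leI) auto
    also have "\<dots> = ennreal (exp 1 / \<kappa>)
      * (ennreal (exp (- w q) * exp 21 powr (- q)) * (\<integral>\<^sup>+x. ennreal (F x powr q) \<partial>M))"
      using \<kappa> by (subst ennreal_mult) (auto simp: mult.assoc)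
    finally show "ennreal (exp 1 * c q) * (\<integral>\<^sup>+x. ennreal (G x powr q) \<partial>M) \<le> \<dots>" .
  qed
  also have "\<dots> = ennreal (exp 1 / \<kappa>) * (\<integral>\<^sup>+x. ennreal (T (F x)) \<partial>M)"
  proof -
    have "ennreal (T (F x))
        = (\<Sum>q\<in>Y. ennreal (exp (- w q) * exp 21 powr (- q)) * ennreal (F x powr q))" for x
    proof -
      have "T (F x) = (\<Sum>q\<in>Y. (exp (- w q) * exp 21 powr (- q)) * F x powr q)"
        unfolding T_def using F0[rule_format, of x]
        by (intro sum.cong refl) (simp add: powr_divide powr_minus field_simps)
      then show ?thesis by (simp add: sum_ennreal[symmetric] ennreal_mult)
    qed
    then have "(\<integral>\<^sup>+x. ennreal (T (F x)) \<partial>M) = (\<Sum>q\<in>Y. ennreal (exp (- w q) * exp 21 powr (- q))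
        * (\<integral>\<^sup>+x. ennreal (F x powr q) \<partial>M))"
      by (simp add: nn_integral_sum nn_integral_cmult)
    then show ?thesis by (simp add: sum_distrib_left)
  qed
  also have "\<dots> \<le> ennreal (exp 1 / \<kappa>) * 18" using intT by (intro mult_left_mono) auto
  also have "\<dots> = ennreal (18 * exp 1 / \<kappa>)"
    using \<kappa> by (simp add: ennreal_mult[symmetric] flip: ennreal_numeral add: mult.commute)
  finally show ?thesis .
qed

text \<open>Monotone convergence along the finite initial segments of an enumeration of
  \<open>D\<close>.\<close>

lemma nn_integral_countable_SUP_le:
  fixes f :: "'i \<Rightarrow> 'a \<Rightarrow> ennreal"
  assumes "countable D" and [measurable]: "\<And>i. i \<in> D \<Longrightarrow> f i \<in> borel_measurable M"
    and le: "\<forall>X. finite X \<longrightarrow> X \<subseteq> D \<longrightarrow> (\<integral>\<^sup>+x. (SUP i\<in>X. f i x) \<partial>M) \<le> c"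
  shows "(\<integral>\<^sup>+x. (SUP i\<in>D. f i x) \<partial>M) \<le> c"
proof (cases "D = {}")
  case True
  then show ?thesis using le by force
next
  case False
  define X where "X n = from_nat_into D ` {..n}" for n
  have X: "finite (X n)" "X n \<subseteq> D" for n
    using from_nat_into[OF False] by (auto simp: X_def)
  have D: "D = (\<Union>n. X n)"
    using range_from_nat_into[OF False assms(1)] by (simp add: X_def flip: image_UN) auto
  have "(SUP i\<in>D. f i x) = (SUP n. SUP i\<in>X n. f i x)" for x
    by (subst D) (rule SUP_UNION)
  then have "(\<integral>\<^sup>+x. (SUP i\<in>D. f i x) \<partial>M) = (\<integral>\<^sup>+x. (SUP n. SUP i\<in>X n. f i x) \<partial>M)"
    by simp
  also have "\<dots> = (SUP n. \<integral>\<^sup>+x. (SUP i\<in>X n. f i x) \<partial>M)"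
  proof (rule nn_integral_monotone_convergence_SUP)
    show "incseq (\<lambda>n x. SUP i\<in>X n. f i x)"
      by (auto simp: incseq_def le_fun_def X_def intro!: SUP_subset_mono)
    show "(\<lambda>x. SUP i\<in>X n. f i x) \<in> borel_measurable M" for n
      using X by (intro borel_measurable_SUP countable_finite assms(2)) auto
  qed
  also have "\<dots> \<le> c" using X le by (intro SUP_least) blast
  finally show ?thesis .
qed

subsection \<open>Lebesgue norms and Young--Orlicz functions\<close>

text \<open>Trades the Bochner integral in \<open>Lp_norm\<close> for a nonnegative integral. For a
  non-integrable power both sides fail, the norm and the integral being infinite.\<close>

lemma Lp_norm_le_iff:
  fixes f :: "'a \<Rightarrow> 'k::{second_countable_topology, real_normed_vector}"
  assumes [measurable]: "f \<in> borel_measurable M" and p: "0 < p" and c: "0 \<le> c"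
  shows "Lp_norm M p f \<le> ennreal c \<longleftrightarrow>
    (\<integral>\<^sup>+x. ennreal (norm (f x) powr p) \<partial>M) \<le> ennreal (c powr p)"
proof (cases "integrable M (\<lambda>x. norm (f x) powr p)")
  case True
  define J where "J = (\<integral>x. norm (f x) powr p \<partial>M)"
  have J: "0 \<le> J" unfolding J_def by (intro integral_nonneg_AE) auto
  have "J powr (1 / p) \<le> c \<longleftrightarrow> J \<le> c powr p"
  proof
    assume "J powr (1 / p) \<le> c"
    then have "(J powr (1 / p)) powr p \<le> c powr p" using p by (intro powr_mono2) auto
    then show "J \<le> c powr p" using p J by (simp add: powr_powr)
  next
    assume "J \<le> c powr p"
    then have "J powr (1 / p) \<le> (c powr p) powr (1 / p)" using p J by (intro powr_mono2) auto
    then show "J powr (1 / p) \<le> c" using p c by (simp add: powr_powr)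
  qed
  then show ?thesis
    using True c J by (simp add: Lp_norm_def nn_integral_eq_integral J_def)
next
  case False
  have "(\<integral>\<^sup>+x. ennreal (norm (f x) powr p) \<partial>M) = \<infinity>"
  proof (rule ccontr)
    assume "\<not> ?thesis"
    then have "integrable M (\<lambda>x. norm (f x) powr p)"
      by (intro integrableI_nonneg) (auto simp: less_top)
    with False show False by simp
  qed
  then show ?thesis using False by (simp add: Lp_norm_def top_unique)
qed

lemma nn_integral_powr_le_of_Lp_norm_le:
  fixes f g :: "'a \<Rightarrow> 'k::{second_countable_topology, real_normed_vector}"
  assumes "f \<in> borel_measurable M" "g \<in> borel_measurable M" "0 < p" "0 \<le> a"
    and fin: "Lp_norm M p f < \<infinity>" and le: "Lp_norm M p g \<le> ennreal a * Lp_norm M p f"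
  shows "(\<integral>\<^sup>+x. ennreal (norm (g x) powr p) \<partial>M)
    \<le> ennreal (a powr p) * (\<integral>\<^sup>+x. ennreal (norm (f x) powr p) \<partial>M)"
proof -
  define J where "J = (\<integral>x. norm (f x) powr p \<partial>M)"
  have int: "integrable M (\<lambda>x. norm (f x) powr p)"
    using fin by (auto simp: Lp_norm_def split: if_splits)
  have J: "0 \<le> J" unfolding J_def by (intro integral_nonneg_AE) auto
  have nnJ: "(\<integral>\<^sup>+x. ennreal (norm (f x) powr p) \<partial>M) = ennreal J"
    using int by (simp add: nn_integral_eq_integral J_def)
  have "Lp_norm M p g \<le> ennreal (a * J powr (1 / p))"
    using le int assms by (simp add: Lp_norm_def J_def ennreal_mult)
  then have "(\<integral>\<^sup>+x. ennreal (norm (g x) powr p) \<partial>M) \<le> ennreal ((a * J powr (1 / p)) powr p)"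
    using assms by (simp add: Lp_norm_le_iff)
  also have "(a * J powr (1 / p)) powr p = a powr p * J"
    using assms J by (simp add: powr_mult powr_powr)
  finally show ?thesis using J by (simp add: nnJ ennreal_mult)
qed

text \<open>Young's inequality with weights \<open>p / q\<close> and \<open>1 - p / q\<close>,
  applied to \<open>(norm (f x) / c) powr q\<close> and 1, then integrated over total mass
  1.\<close>

lemma (in prob_space) Lp_norm_mono_exponent:
  fixes f :: "'a \<Rightarrow> 'k::{second_countable_topology, real_normed_vector}"
  assumes [measurable]: "f \<in> borel_measurable M" and p: "0 < p" "p \<le> q"
  shows "Lp_norm M p f \<le> Lp_norm M q f"
proof (rule ennreal_le_epsilon)
  fix e :: real assume fin: "Lp_norm M q f < top" and e: "0 < e"
  \<comment> \<open>Adding \<open>e\<close> keeps \<open>c\<close> positive even when the norm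
    vanishes, so that division by \<open>c\<close> is legitimate.\<close>
  define c where "c = enn2real (Lp_norm M q f) + e"
  have c: "0 < c" using e by (simp add: c_def add_nonneg_pos)
  have cq: "ennreal c = Lp_norm M q f + ennreal e"
    using fin e by (simp add: c_def)
  have "Lp_norm M q f \<le> ennreal c" by (simp add: cq)
  then have q: "(\<integral>\<^sup>+x. ennreal (norm (f x) powr q) \<partial>M) \<le> ennreal (c powr q)"
    using c p by (simp add: Lp_norm_le_iff)
  define \<alpha> where "\<alpha> = p / q"
  have \<alpha>: "0 \<le> \<alpha>" "\<alpha> \<le> 1" using p by (auto simp: \<alpha>_def)
  have young: "norm (f x) powr p \<le> c powr p * (\<alpha> * (norm (f x) powr q / c powr q) + (1 - \<alpha>))" for x
  proof (cases "f x = 0")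
    case True
    then show ?thesis using \<alpha> by simp
  next
    case False
    have "((norm (f x) / c) powr q) powr \<alpha> * 1 powr (1 - \<alpha>)
        \<le> \<alpha> * ((norm (f x) / c) powr q) + (1 - \<alpha>) * 1"
      using \<alpha> c False by (intro Youngs_inequality_0) auto
    moreover have "((norm (f x) / c) powr q) powr \<alpha> = (norm (f x) / c) powr p"
      using p by (simp add: \<alpha>_def powr_powr)
    ultimately have "(norm (f x) / c) powr p \<le> \<alpha> * ((norm (f x) / c) powr q) + (1 - \<alpha>)" by simp
    then show ?thesis using c by (simp add: powr_divide field_simps)
  qed
  have "(\<integral>\<^sup>+x. ennreal (norm (f x) powr p) \<partial>M)
      \<le> (\<integral>\<^sup>+x. ennreal (c powr p * \<alpha> / c powr q) * ennreal (norm (f x) powr q)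
          + ennreal (c powr p * (1 - \<alpha>)) \<partial>M)"
  proof (intro nn_integral_mono)
    fix x
    show "ennreal (norm (f x) powr p) \<le> ennreal (c powr p * \<alpha> / c powr q)
        * ennreal (norm (f x) powr q) + ennreal (c powr p * (1 - \<alpha>))"
    proof -
      have "norm (f x) powr p \<le> c powr p * \<alpha> / c powr q * norm (f x) powr q + c powr p * (1 - \<alpha>)"
        using young[of x] by (simp add: algebra_simps)
      then have "ennreal (norm (f x) powr p)
          \<le> ennreal (c powr p * \<alpha> / c powr q * norm (f x) powr q + c powr p * (1 - \<alpha>))"
        by (rule ennreal_leI)
      then show ?thesis using \<alpha> by (subst (asm) ennreal_plus) (auto simp flip: ennreal_mult)
    qed
  qed
  also have "\<dots> = ennreal (c powr p * \<alpha> / c powr q) * (\<integral>\<^sup>+x. ennreal (norm (f x) powr q) \<partial>M)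
      + ennreal (c powr p * (1 - \<alpha>))"
    by (subst nn_integral_add) (auto simp: nn_integral_cmult emeasure_space_1)
  also have "\<dots> \<le> ennreal (c powr p * \<alpha> / c powr q) * ennreal (c powr q)
      + ennreal (c powr p * (1 - \<alpha>))"
    by (intro add_mono mult_left_mono q) auto
  also have "\<dots> = ennreal (c powr p)"
    using c \<alpha> by (simp add: ennreal_mult[symmetric] ennreal_plus[symmetric]
          algebra_simps del: ennreal_plus)
  finally have "Lp_norm M p f \<le> ennreal c" using c p by (simp add: Lp_norm_le_iff)
  then show "Lp_norm M p f \<le> Lp_norm M q f + ennreal e" by (simp add: cq)
qed

lemma young_orlicz_ge:
  assumes "1 \<le> p" "\<phi> p < \<infinity>" "exp 1 \<le> y"
  shows "ennreal (exp (p * ln y - p * ln (enn2real (\<phi> p)))) \<le> young_orlicz C0 \<phi> y"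
proof -
  have y: "0 < y" using assms exp_gt_zero[of 1] by linarith
  have le: "ereal (p * ln y - p * ln (enn2real (\<phi> p))) \<le> young_fenchel \<phi> (ln y)"
    unfolding young_fenchel_def by (rule SUP_upper) (use assms in auto)
  then show ?thesis using assms y
    by (cases "young_fenchel \<phi> (ln y)")
      (auto simp: young_orlicz_def exp_ereal_def intro!: ennreal_leI)
qed

text \<open>The exponential of the supremum is the supremum of the exponentials, so testing single
  exponents is enough; if no exponent is finite, the value at \<open>y\<close> is 0.\<close>

lemma young_orlicz_le:
  assumes y: "exp 1 \<le> y"
    and le: "\<And>p. \<lbrakk>1 \<le> p; \<phi> p < \<infinity>\<rbrakk> \<Longrightarrow>
        ennreal (exp (p * ln y - p * ln (enn2real (\<phi> p)))) \<le> c"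
  shows "young_orlicz C0 \<phi> y \<le> c"
proof (cases c)
  case (real t)
  have y0: "0 < y" using y exp_gt_zero[of 1] by linarith
  show ?thesis
  proof (cases "{p. 1 \<le> p \<and> \<phi> p < \<infinity>} = {}")
    case True
    then have "young_fenchel \<phi> (ln y) = - \<infinity>"
      unfolding young_fenchel_def True by (simp add: bot_ereal_def)
    then show ?thesis using y y0 by (simp add: young_orlicz_def exp_ereal_def)
  next
    case False
    have t: "exp (p * ln y - p * ln (enn2real (\<phi> p))) \<le> t" if "1 \<le> p" "\<phi> p < \<infinity>" for p
      using le[OF that] real by simp
    have t0: "0 < t" using False t by (auto intro: less_le_trans[OF exp_gt_zero])
    have "p * ln y - p * ln (enn2real (\<phi> p)) \<le> ln t" if "1 \<le> p" "\<phi> p < \<infinity>" for p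
      using t[OF that] t0 by (metis ln_exp ln_mono exp_gt_zero)
    then have "young_fenchel \<phi> (ln y) \<le> ereal (ln t)"
      unfolding young_fenchel_def by (intro SUP_least) auto
    then have "exp_ereal (young_fenchel \<phi> (ln y)) \<le> ennreal (exp (ln t))"
      by (cases "young_fenchel \<phi> (ln y)") (auto simp: exp_ereal_def intro!: ennreal_leI)
    then show ?thesis using real t0 y y0 by (simp add: young_orlicz_def)
  qed
qed simp

text \<open>Rational points above \<open>p\<close> and below \<open>b\<close> accumulate at
  \<open>p\<close>, and the bound passes to the limit; approaching from the right stays in range
  even at an irrational \<open>p = p0\<close>. This makes the supremum over exponents
  countable.\<close>

lemma continuous_on_le_of_rational_le:
  fixes h :: "real \<Rightarrow> real"
  assumes cont: "continuous_on {p. p0 \<le> p \<and> ereal p < b} h"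
    and le: "\<And>r. \<lbrakk>r \<in> \<rat>; p0 \<le> r; ereal r < b\<rbrakk> \<Longrightarrow> h r \<le> c"
    and p: "p0 \<le> p" "ereal p < b"
  shows "h p \<le> c"
proof -
  let ?D = "{r \<in> \<rat>. p0 \<le> r \<and> ereal r < b}"
  have "p islimpt ?D"
    unfolding islimpt_approachable_real
  proof (intro allI impI)
    fix e :: real assume e: "0 < e"
    have "ereal p < min (ereal (p + e)) b" using p e by simp
    then obtain s where s: "ereal p < ereal s" "ereal s < min (ereal (p + e)) b"
      using ereal_dense2 by blast
    then obtain r where r: "r \<in> \<rat>" "p < r" "r < s" using Rats_dense_in_real[of p s] by auto
    have "ereal r < ereal s" using r by simp
    also have "\<dots> < b" using s by simp
    finally have "ereal r < b" .
    then show "\<exists>x'\<in>?D. x' \<noteq> p \<and> \<bar>x' - p\<bar> < e"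
      using r s p by (intro bexI[of _ r]) auto
  qed
  then have "at p within ?D \<noteq> bot" by (simp add: trivial_limit_within)
  moreover have "(h \<longlongrightarrow> h p) (at p within ?D)"
    using cont p unfolding continuous_on by (auto intro: tendsto_within_subset)
  ultimately show ?thesis
    using le by (intro tendsto_upperbound[of h "h p" "at p within ?D"])
      (auto simp: eventually_at_filter intro!: always_eventually)
qed

subsection \<open>The transfer between Orlicz spaces\<close>

context
  fixes b :: ereal and \<psi> :: "real \<Rightarrow> ennreal"
  assumes \<psi>: "\<psi> \<in> Psi b"
begin

lemma Psi_finite: "\<lbrakk>1 \<le> p; ereal p < b\<rbrakk> \<Longrightarrow> \<psi> p < \<infinity>"
  using \<psi> unfolding Psi_def by blast

lemma Psi_ge_1:
  assumes "1 \<le> p" "ereal p < b"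
  shows "1 \<le> \<psi> p"
proof -
  have "(INF p\<in>{p. 1 \<le> p \<and> ereal p < b}. \<psi> p) = 1" using \<psi> unfolding Psi_def by blast
  moreover have "(INF p\<in>{p. 1 \<le> p \<and> ereal p < b}. \<psi> p) \<le> \<psi> p"
    by (rule INF_lower) (use assms in auto)
  ultimately show ?thesis by simp
qed

lemma Psi_enn2real:
  assumes "1 \<le> p" "ereal p < b"
  shows "\<psi> p = ennreal (enn2real (\<psi> p))" "1 \<le> enn2real (\<psi> p)"
proof -
  show "\<psi> p = ennreal (enn2real (\<psi> p))" "1 \<le> enn2real (\<psi> p)"
    using Psi_finite[OF assms] Psi_ge_1[OF assms] by (cases "\<psi> p"; simp)+
qed

lemma continuous_on_ln_Psi:
  "continuous_on {p. 1 \<le> p \<and> ereal p < b} (\<lambda>p. ln (enn2real (\<psi> p)))"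
proof (rule continuous_on_ln)
  have "continuous_on {p. 1 \<le> p \<and> ereal p < b} \<psi>" using \<psi> unfolding Psi_def by blast
  then show "continuous_on {p. 1 \<le> p \<and> ereal p < b} (\<lambda>p. enn2real (\<psi> p))"
    unfolding continuous_on_def using Psi_finite by (auto intro!: tendsto_enn2real)
  show "\<forall>p\<in>{p. 1 \<le> p \<and> ereal p < b}. enn2real (\<psi> p) \<noteq> 0"
    using Psi_enn2real(2) by force
qed

lemma zeta_finite_iff:
  assumes "1 \<le> p"
  shows "zeta b \<psi> \<Delta> p < \<infinity> \<longleftrightarrow> ereal p < b"
  using assms Psi_finite[OF assms] by (auto simp: zeta_def ennreal_mult_less_top)

lemma zeta_ge_1:
  assumes "1 \<le> p" "0 \<le> \<Delta>"
  shows "1 \<le> zeta b \<psi> \<Delta> p"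
proof (cases "ereal p < b")
  case True
  have "1 * 1 \<le> ennreal (p powr \<Delta>) * \<psi> p"
    using assms Psi_ge_1[OF assms(1) True] by (intro mult_mono) (auto simp: ge_one_powr_ge_zero)
  then show ?thesis using True assms by (simp add: zeta_def)
qed (simp add: zeta_def)

lemma p_ln_zeta:
  assumes "1 \<le> p" "ereal p < b"
  shows "p * ln (enn2real (zeta b \<psi> \<Delta> p)) = p * ln (enn2real (\<psi> p)) + \<Delta> * (p * ln p)"
proof -
  have "enn2real (zeta b \<psi> \<Delta> p) = p powr \<Delta> * enn2real (\<psi> p)"
    using assms by (simp add: zeta_def enn2real_mult)
  then show ?thesis
    using assms Psi_enn2real(2)[OF assms] by (simp add: ln_mult ln_powr algebra_simps)
qed

text \<open>For \<open>y < exp 1\<close>, \<open>p0 < 2\<close> gives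
  \<open>y\<^sup>2 \<le> exp 2 * y powr p0\<close>. For \<open>y \<ge> exp 1\<close>, exponents
  below \<open>p0\<close> yield at most \<open>y powr p0\<close> since
  \<open>\<psi> \<ge> 1\<close>, and the others are reached by continuity from rational ones. The
  two origins of \<open>y powr p0\<close> account for the 1 and the \<open>C0 * exp 2\<close> in its
  coefficient.\<close>

lemma young_orlicz_zeta_le:
  assumes p0: "1 < p0" "p0 < 2" "ereal p0 < b" and \<Delta>: "0 \<le> \<Delta>" and C0: "0 < C0" and y: "0 \<le> y"
  shows "young_orlicz C0 (zeta b \<psi> \<Delta>) y \<le> ennreal ((1 + C0 * exp 2) * y powr p0)
    + (SUP r\<in>{r\<in>\<rat>. p0 \<le> r \<and> ereal r < b}.
        ennreal (y powr r * exp (- (r * ln (enn2real (\<psi> r))) - \<Delta> * (r * ln r))))"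
    (is "_ \<le> ?a + ?S")
proof (cases "exp 1 \<le> y")
  case False
  have "C0 * y\<^sup>2 \<le> (1 + C0 * exp 2) * y powr p0"
  proof (cases "y = 0")
    case False
    then have y0: "0 < y" using y by simp
    have "y\<^sup>2 = y powr (2 - p0) * y powr p0" using y0 powr_add[of y "2 - p0" p0] by simp
    also have "y powr (2 - p0) \<le> exp 1 powr (2 - p0)"
      using \<open>\<not> exp 1 \<le> y\<close> y p0 by (intro powr_mono2) auto
    also have "exp 1 powr (2 - p0) \<le> exp (2::real)" using p0 by (simp add: powr_def)
    finally have "C0 * y\<^sup>2 \<le> C0 * (exp 2 * y powr p0)"
      using C0 by (intro mult_left_mono) (auto simp: mult_right_mono)
    also have "\<dots> \<le> (1 + C0 * exp 2) * y powr p0" by (simp add: algebra_simps)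
    finally show ?thesis .
  qed simp
  then have "ennreal (C0 * y\<^sup>2) \<le> ?a" by (rule ennreal_leI)
  then show ?thesis using False y by (simp add: young_orlicz_def add_increasing2)
next
  case True
  then have "1 \<le> y" using exp_ge_add_one_self[of 1] by linarith
  then have y0: "0 < y" "1 \<le> y" "0 \<le> ln y" by auto
  show ?thesis
  proof (rule young_orlicz_le[OF True])
    fix p assume p: "1 \<le> p" and "zeta b \<psi> \<Delta> p < \<infinity>"
    then have pb: "ereal p < b" using zeta_finite_iff by blast
    define h where "h p = p * ln y - p * ln (enn2real (\<psi> p)) - \<Delta> * (p * ln p)" for p
    have h_eq: "exp (h r) = y powr r * exp (- (r * ln (enn2real (\<psi> r))) - \<Delta> * (r * ln r))" for r
      using y0 by (simp add: h_def powr_def flip: exp_add)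
    have "ennreal (exp (h p)) \<le> ?a + ?S"
    proof (cases "p0 \<le> p")
      case False
      have "0 \<le> p * ln (enn2real (\<psi> p))" "0 \<le> \<Delta> * (p * ln p)"
        using p \<Delta> Psi_enn2real(2)[OF p pb] by auto
      then have "h p \<le> p * ln y" by (simp add: h_def)
      also have "\<dots> \<le> p0 * ln y" using False y0 by (intro mult_right_mono) auto
      finally have "exp (h p) \<le> 1 * y powr p0" using y0 by (simp add: powr_def)
      also have "\<dots> \<le> (1 + C0 * exp 2) * y powr p0" using C0 by (intro mult_right_mono) auto
      finally have "ennreal (exp (h p)) \<le> ?a" by (rule ennreal_leI)
      then show ?thesis by (simp add: add_increasing2)
    next
      case True
      have "ennreal (exp (h p)) \<le> ?S"
      proof (cases ?S)
        case (real t)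
        have le: "exp (h r) \<le> t" if "r \<in> \<rat>" "p0 \<le> r" "ereal r < b" for r
        proof -
          have "ennreal (exp (h r)) \<le> ?S"
            unfolding h_eq by (rule SUP_upper) (use that in auto)
          then show ?thesis using real by simp
        qed
        have "continuous_on {p. p0 \<le> p \<and> ereal p < b} (\<lambda>p. exp (h p))"
          unfolding h_def using p0
          by (intro continuous_intros continuous_on_subset[OF continuous_on_ln_Psi]) auto
        then have "exp (h p) \<le> t"
          by (rule continuous_on_le_of_rational_le) (use le True pb in auto)
        then show ?thesis using real by (simp add: ennreal_leI)
      next
        case top
        then show ?thesis by (simp only: top_greatest)
      qed
      then show ?thesis by (simp add: add_increasing)
    qed
    then show "ennreal (exp (p * ln y - p * ln (enn2real (zeta b \<psi> \<Delta> p)))) \<le> ?a + ?S"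
      using p_ln_zeta[OF p pb] by (simp add: h_def algebra_simps)
  qed
qed

text \<open>\<open>C\<close> is chosen before the measure space and the functions, so it serves all
  operators at once. \<open>F\<close> and \<open>G\<close> stand for \<open>norm (f x) / k\<close>
  and \<open>norm (Q f x) / (Z * k)\<close>; an integral of at most 1 is what the Luxemburg norm
  asks for.\<close>

lemma young_orlicz_transfer:
  fixes \<nu> \<Delta> C0 :: real
  assumes b: "1 < b" and "0 \<le> \<nu>" "0 \<le> \<Delta>" "0 < C0"
  shows "\<exists>C>0. \<forall>(M :: 'a measure) F G. prob_space M \<longrightarrow>
    F \<in> borel_measurable M \<longrightarrow> G \<in> borel_measurable M \<longrightarrow> (\<forall>x. 0 \<le> F x) \<longrightarrow> (\<forall>x. 0 \<le> G x) \<longrightarrow>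
    (\<forall>q. 1 < q \<longrightarrow> ereal q < b \<longrightarrow> (\<integral>\<^sup>+x. ennreal (G x powr q) \<partial>M)
      \<le> ennreal (((q / (q - 1)) powr \<nu> * q powr \<Delta>) powr q) * (\<integral>\<^sup>+x. ennreal (F x powr q) \<partial>M)) \<longrightarrow>
    (\<integral>\<^sup>+x. young_orlicz C0 \<psi> (F x) \<partial>M) \<le> 1 \<longrightarrow>
    (\<integral>\<^sup>+x. young_orlicz C0 (zeta b \<psi> \<Delta>) (G x / C) \<partial>M) \<le> 1"
proof -
  \<comment> \<open>Exponents below \<open>p0\<close> are dominated by \<open>p0\<close> itself; this avoids the singularity of
    \<open>(q / (q - 1)) powr \<nu>\<close> at 1, and \<open>p0 < 2\<close> also controls the quadratic part of the
    Young--Orlicz function.\<close>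
  have "ereal 1 < min b (ereal 2)" using b by (cases b) auto
  then obtain p0 where "ereal 1 < ereal p0" "ereal p0 < min b (ereal 2)" using ereal_dense2 by blast
  then have p0: "1 < p0" "p0 < 2" "ereal p0 < b" by auto
  define I where "I = {p. p0 \<le> p \<and> ereal p < b}"
  define v where "v p = p * ln (enn2real (\<psi> p))" for p
  \<comment> \<open>\<open>B\<close> dominates the singular factor for exponents from
    \<open>p0\<close> on, \<open>m\<close> and \<open>a\<close> bound the moments of order
    \<open>p0\<close> of \<open>F\<close> and \<open>G\<close>, and \<open>\<kappa>\<close> makes
    the two contributions to the final integral at most 1/2 each.\<close>
  define B where "B = (p0 / (p0 - 1)) powr \<nu>"
  define m where "m = exp 2 + exp (v p0)"
  define a where "a = B powr p0 * exp (\<Delta> * (p0 * ln p0)) * m"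
  define \<kappa> where "\<kappa> = 1 + 36 * exp 1 + 2 * ((1 + C0 * exp 2) * a)"
  define C where "C = 2 powr \<Delta> * B * exp 21 * \<kappa>"
  have "1 \<le> p0 / (p0 - 1)" using p0 by simp
  then have B: "1 \<le> B" using assms by (simp add: B_def ge_one_powr_ge_zero)
  have m: "0 < m" unfolding m_def by (intro add_pos_pos) auto
  then have a: "0 < a" using B by (simp add: a_def)
  have \<kappa>: "1 \<le> \<kappa>" "36 * exp 1 \<le> \<kappa>" "2 * ((1 + C0 * exp 2) * a) \<le> \<kappa>"
    using a \<open>0 < C0\<close> by (auto simp: \<kappa>_def add_increasing2 intro!: add_nonneg_nonneg)
  have C\<kappa>: "\<kappa> \<le> C"
  proof -
    have "1 \<le> 2 powr \<Delta> * B * exp 21"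
      using B \<open>0 \<le> \<Delta>\<close> by (intro mult_ge1_I) (auto simp: ge_one_powr_ge_zero)
    then show ?thesis using \<kappa>(1) by (simp add: C_def)
  qed
  then have C: "1 \<le> C" using \<kappa> by linarith
  have I1: "1 \<le> p" "ereal p < b" "1 < p" if "p \<in> I" for p using that p0 by (auto simp: I_def)
  show ?thesis
  proof (intro exI[of _ C] conjI allI impI)
    show "0 < C" using C by simp
    fix M :: "'a measure" and F G :: "'a \<Rightarrow> real"
    assume M: "prob_space M" and F[measurable]: "F \<in> borel_measurable M"
      and G[measurable]: "G \<in> borel_measurable M"
      and F0: "\<forall>x. 0 \<le> F x" and G0: "\<forall>x. 0 \<le> G x"
      and mom: "\<forall>q. 1 < q \<longrightarrow> ereal q < b \<longrightarrow> (\<integral>\<^sup>+x. ennreal (G x powr q) \<partial>M)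
      \<le> ennreal (((q / (q - 1)) powr \<nu> * q powr \<Delta>) powr q) * (\<integral>\<^sup>+x. ennreal (F x powr q) \<partial>M)"
      and int: "(\<integral>\<^sup>+x. young_orlicz C0 \<psi> (F x) \<partial>M) \<le> 1"
    interpret prob_space M by fact
    have moments: "\<forall>q\<in>I. (\<integral>\<^sup>+x. ennreal (G x powr q) \<partial>M)
        \<le> ennreal (B powr q * exp (\<Delta> * (q * ln q))) * (\<integral>\<^sup>+x. ennreal (F x powr q) \<partial>M)"
    proof
      fix q assume q: "q \<in> I"
      have "q / (q - 1) \<le> p0 / (p0 - 1)" using q p0 by (simp add: I_def field_simps)
      then have "(q / (q - 1)) powr \<nu> \<le> B"
        unfolding B_def using I1[OF q] \<open>0 \<le> \<nu>\<close> by (intro powr_mono2) auto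
      then have le: "((q / (q - 1)) powr \<nu>) powr q \<le> B powr q"
        using I1[OF q] by (intro powr_mono2) auto
      have "((q / (q - 1)) powr \<nu> * q powr \<Delta>) powr q = ((q / (q - 1)) powr \<nu>) powr q * (q powr \<Delta>) powr q"
        by (simp add: powr_mult)
      also have "\<dots> \<le> B powr q * (q powr \<Delta>) powr q"
        using le by (rule mult_right_mono) simp
      also have "(q powr \<Delta>) powr q = exp (\<Delta> * (q * ln q))"
        using I1[OF q] by (simp add: powr_powr) (simp add: powr_def mult.commute mult.left_commute)
      finally have "((q / (q - 1)) powr \<nu> * q powr \<Delta>) powr q \<le> B powr q * exp (\<Delta> * (q * ln q))" .
      then have "ennreal (((q / (q - 1)) powr \<nu> * q powr \<Delta>) powr q) * (\<integral>\<^sup>+x. ennreal (F x powr q) \<partial>M)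
        \<le> ennreal (B powr q * exp (\<Delta> * (q * ln q))) * (\<integral>\<^sup>+x. ennreal (F x powr q) \<partial>M)"
        by (intro mult_right_mono ennreal_leI) auto
      then show "(\<integral>\<^sup>+x. ennreal (G x powr q) \<partial>M)
        \<le> ennreal (B powr q * exp (\<Delta> * (q * ln q))) * (\<integral>\<^sup>+x. ennreal (F x powr q) \<partial>M)"
        using mom I1[OF q] by (meson order_trans)
    qed
    have \<Phi>: "\<forall>p\<in>I. \<forall>y\<ge>exp 1. ennreal (exp (p * ln y - v p)) \<le> young_orlicz C0 \<psi> y"
      unfolding v_def using I1 Psi_finite by (auto intro!: young_orlicz_ge)
    have p0I: "p0 \<in> I" using p0 by (simp add: I_def)

    have "(\<integral>\<^sup>+x. (SUP r\<in>{r\<in>\<rat>. p0 \<le> r \<and> ereal r < b}.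
        ennreal ((G x / C) powr r * exp (- v r - \<Delta> * (r * ln r)))) \<partial>M) \<le> ennreal (18 * exp 1 / \<kappa>)"
    proof (rule nn_integral_countable_SUP_le)
      show "countable {r\<in>\<rat>. p0 \<le> r \<and> ereal r < b}"
        by (rule countable_subset[OF _ countable_rat]) auto
      show "\<forall>X. finite X \<longrightarrow> X \<subseteq> {r\<in>\<rat>. p0 \<le> r \<and> ereal r < b} \<longrightarrow>
        (\<integral>\<^sup>+x. (SUP r\<in>X. ennreal ((G x / C) powr r * exp (- v r - \<Delta> * (r * ln r)))) \<partial>M)
          \<le> ennreal (18 * exp 1 / \<kappa>)"
      proof (intro allI impI)
        fix X assume X: "finite X" "X \<subseteq> {r\<in>\<rat>. p0 \<le> r \<and> ereal r < b}"
        show "(\<integral>\<^sup>+x. (SUP r\<in>X. ennreal ((G x / C) powr r * exp (- v r - \<Delta> * (r * ln r)))) \<partial>M)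
          \<le> ennreal (18 * exp 1 / \<kappa>)"
          unfolding C_def
        proof (rule nn_integral_finite_max_le[OF M F G F0 G0 _ _ _ _ X(1) _ _ _ _ moments \<Phi> int])
          show "\<forall>p\<in>I. 0 \<le> v p" unfolding v_def using I1 Psi_enn2real(2)
            by (intro ballI mult_nonneg_nonneg ln_ge_zero order_trans[OF zero_le_one]) blast+
          show "is_interval I" unfolding is_interval_1 I_def
            by auto (meson ereal_less_eq(3) le_less_trans)
          show "\<forall>p\<in>I. 1 \<le> p" using I1 by blast
          show "I \<noteq> {}" using p0I by blast
          show "X \<subseteq> I" using X by (auto simp: I_def)
          show "0 < B" using B by simp
        qed fact+
      qed
    qed measurable
    also have "\<dots> \<le> ennreal (1 / 2)" using \<kappa> by (intro ennreal_leI) (simp add: field_simps)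
    finally have sup: "(\<integral>\<^sup>+x. (SUP r\<in>{r\<in>\<rat>. p0 \<le> r \<and> ereal r < b}.
        ennreal ((G x / C) powr r * exp (- v r - \<Delta> * (r * ln r)))) \<partial>M) \<le> ennreal (1 / 2)" .

    \<comment> \<open>Where \<open>F x < exp 1\<close> the power is at most \<open>exp 2\<close>;
      elsewhere the single exponent \<open>p0\<close> in the supremum behind
      \<open>young_orlicz\<close> controls it. The two parts add up to \<open>m\<close>.\<close>
    have "(\<integral>\<^sup>+x. ennreal (F x powr p0) \<partial>M)
        \<le> (\<integral>\<^sup>+x. ennreal (exp 2) + ennreal (exp (v p0))
          * (ennreal (exp (- v p0) * F x powr p0) * indicator {x. exp 1 \<le> F x} x) \<partial>M)"
    proof (intro nn_integral_mono)
      fix x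
      show "ennreal (F x powr p0) \<le> ennreal (exp 2) + ennreal (exp (v p0))
          * (ennreal (exp (- v p0) * F x powr p0) * indicator {x. exp 1 \<le> F x} x)"
      proof (cases "exp 1 \<le> F x")
        case True
        have "ennreal (F x powr p0) = ennreal (exp (v p0)) * ennreal (exp (- v p0) * F x powr p0)"
          by (simp flip: ennreal_mult add: exp_minus)
        then show ?thesis using True by (simp add: add_increasing)
      next
        case False
        have "F x powr p0 \<le> exp 1 powr p0" using False F0 p0 by (intro powr_mono2) auto
        also have "\<dots> \<le> exp 2" using p0 by (simp add: powr_def)
        finally show ?thesis using False by (simp add: ennreal_leI)
      qed
    qed
    also have "\<dots> = ennreal (exp 2) + ennreal (exp (v p0))
        * (\<integral>\<^sup>+x. ennreal (exp (- v p0) * F x powr p0) * indicator {x. exp 1 \<le> F x} x \<partial>M)"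
      by (subst nn_integral_add) (auto simp: nn_integral_cmult emeasure_space_1)
    also have "\<dots> \<le> ennreal (exp 2) + ennreal (exp (v p0)) * (\<integral>\<^sup>+x. young_orlicz C0 \<psi> (F x) \<partial>M)"
    proof (intro add_left_mono mult_left_mono nn_integral_mono)
      fix x
      have "exp 1 \<le> F x \<Longrightarrow> exp (- v p0) * F x powr p0 = exp (p0 * ln (F x) - v p0)"
        using exp_gt_zero[of 1] by (auto simp: powr_def exp_diff exp_minus field_simps)
      then show "ennreal (exp (- v p0) * F x powr p0) * indicator {x. exp 1 \<le> F x} x
          \<le> young_orlicz C0 \<psi> (F x)"
        using \<Phi> p0I by (auto simp: indicator_def)
    qed auto
    also have "\<dots> \<le> ennreal (exp 2) + ennreal (exp (v p0)) * 1"
      by (intro add_left_mono mult_left_mono int) auto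
    also have "\<dots> = ennreal m" by (simp add: m_def)
    finally have Fp0: "(\<integral>\<^sup>+x. ennreal (F x powr p0) \<partial>M) \<le> ennreal m" .
    have "(\<integral>\<^sup>+x. ennreal (G x powr p0) \<partial>M) \<le> ennreal (B powr p0 * exp (\<Delta> * (p0 * ln p0))) * ennreal m"
      by (rule order_trans[OF bspec[OF moments p0I] mult_left_mono[OF Fp0]]) simp
    also have "\<dots> = ennreal a" using m by (simp add: a_def ennreal_mult)
    finally have Gp0: "(\<integral>\<^sup>+x. ennreal (G x powr p0) \<partial>M) \<le> ennreal a" .
    have "(\<integral>\<^sup>+x. ennreal ((1 + C0 * exp 2) * (G x / C) powr p0) \<partial>M)
        \<le> (\<integral>\<^sup>+x. ennreal ((1 + C0 * exp 2) / \<kappa>) * ennreal (G x powr p0) \<partial>M)"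
    proof (intro nn_integral_mono)
      fix x
      have "(G x / C) powr p0 = G x powr p0 * (1 / C powr p0)"
        using G0 C by (simp add: powr_divide)
      also have "\<dots> \<le> G x powr p0 * (1 / \<kappa>)"
      proof (intro mult_left_mono divide_left_mono)
        have "C powr 1 \<le> C powr p0" using C p0 by (intro powr_mono) auto
        then show "\<kappa> \<le> C powr p0" using C\<kappa> C by simp
      qed (use \<kappa> C in auto)
      finally have "(1 + C0 * exp 2) * (G x / C) powr p0 \<le> (1 + C0 * exp 2) * (G x powr p0 * (1 / \<kappa>))"
        using \<open>0 < C0\<close> by (intro mult_left_mono) auto
      then show "ennreal ((1 + C0 * exp 2) * (G x / C) powr p0)
          \<le> ennreal ((1 + C0 * exp 2) / \<kappa>) * ennreal (G x powr p0)"
        using \<open>0 < C0\<close> \<kappa> by (simp flip: ennreal_mult add: ennreal_leI)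
    qed
    also have "\<dots> = ennreal ((1 + C0 * exp 2) / \<kappa>) * (\<integral>\<^sup>+x. ennreal (G x powr p0) \<partial>M)"
      by (rule nn_integral_cmult) auto
    also have "\<dots> \<le> ennreal ((1 + C0 * exp 2) / \<kappa>) * ennreal a" by (intro mult_left_mono Gp0) auto
    also have "\<dots> = ennreal ((1 + C0 * exp 2) * a / \<kappa>)"
      using \<open>0 < C0\<close> \<kappa> a by (simp flip: ennreal_mult)
    also have "\<dots> \<le> ennreal (1 / 2)"
      using \<kappa> by (intro ennreal_leI) (simp add: field_simps)
    finally have small: "(\<integral>\<^sup>+x. ennreal ((1 + C0 * exp 2) * (G x / C) powr p0) \<partial>M) \<le> ennreal (1 / 2)" .

    have "(\<integral>\<^sup>+x. young_orlicz C0 (zeta b \<psi> \<Delta>) (G x / C) \<partial>M)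
        \<le> (\<integral>\<^sup>+x. ennreal ((1 + C0 * exp 2) * (G x / C) powr p0)
          + (SUP r\<in>{r\<in>\<rat>. p0 \<le> r \<and> ereal r < b}.
              ennreal ((G x / C) powr r * exp (- v r - \<Delta> * (r * ln r)))) \<partial>M)"
      unfolding v_def using p0 assms C G0
      by (intro nn_integral_mono young_orlicz_zeta_le) auto
    also have "\<dots> = (\<integral>\<^sup>+x. ennreal ((1 + C0 * exp 2) * (G x / C) powr p0) \<partial>M)
        + (\<integral>\<^sup>+x. (SUP r\<in>{r\<in>\<rat>. p0 \<le> r \<and> ereal r < b}.
              ennreal ((G x / C) powr r * exp (- v r - \<Delta> * (r * ln r)))) \<partial>M)"
    proof (rule nn_integral_add)
      show "(\<lambda>x. SUP r\<in>{r\<in>\<rat>. p0 \<le> r \<and> ereal r < b}.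
          ennreal ((G x / C) powr r * exp (- v r - \<Delta> * (r * ln r)))) \<in> borel_measurable M"
        by (rule borel_measurable_SUP[OF countable_subset[OF _ countable_rat]]) auto
    qed measurable
    also have "\<dots> \<le> ennreal (1 / 2) + ennreal (1 / 2)" by (intro add_mono small sup)
    also have "\<dots> = 1" by (subst ennreal_plus[symmetric]) auto
    finally show "(\<integral>\<^sup>+x. young_orlicz C0 (zeta b \<psi> \<Delta>) (G x / C) \<partial>M) \<le> 1" .
  qed
qed

end

subsection \<open>The main estimates\<close>

text \<open>The second premise excludes \<open>c = 0\<close> with empty \<open>A\<close>, where the
  right-hand side would be \<open>0 * top = 0\<close>.\<close>

lemma le_mult_INF_ennreal:
  fixes c x :: ennreal
  assumes "c < top" "A \<noteq> {} \<or> c \<noteq> 0" and le: "\<And>i. i \<in> A \<Longrightarrow> x \<le> c * h i"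
  shows "x \<le> c * (INF i\<in>A. h i)"
proof (cases "c = 0")
  case True
  then show ?thesis using assms by auto
next
  case False
  have "x / c \<le> (INF i\<in>A. h i)"
    using False le by (intro INF_greatest divide_le_posI_ennreal) (auto simp: zero_less_iff_neq_zero)
  then have "c * (x / c) \<le> c * (INF i\<in>A. h i)" by (rule mult_left_mono) simp
  moreover have "c * (x / c) = x"
    using False \<open>c < top\<close> by (simp add: ennreal_times_divide ennreal_mult_divide_eq mult.commute[of c])
  ultimately show ?thesis by simp
qed

lemma K_const_integrand_eq:
  assumes "1 < q"
  shows "ennreal (q powr \<nu>) * z / ennreal ((q - 1) powr \<nu>) = ennreal ((q / (q - 1)) powr \<nu>) * z"
proof -
  have "ennreal (q powr \<nu>) * z / ennreal ((q - 1) powr \<nu>)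
      = (ennreal (q powr \<nu>) / ennreal ((q - 1) powr \<nu>)) * z"
    by (simp add: ennreal_divide_times ennreal_times_divide mult.commute)
  then show ?thesis using assms by (simp add: divide_ennreal powr_divide)
qed

theorem theorem4p1:
  fixes b :: ereal and \<psi> :: "real \<Rightarrow> ennreal" and lam \<nu> \<Delta> C0 :: real
    and \<zeta> :: "real \<Rightarrow> ennreal"
  assumes "1 < b" and "\<psi> \<in> Psi b"
    and "0 \<le> \<nu>" and "\<nu> < lam" and "\<Delta> = lam - \<nu>"
    and "\<zeta> = zeta b \<psi> \<Delta>"
    and "0 < C0"
  shows "\<exists>C::real. 0 < C \<and>
    (\<forall>(M :: 'a measure) (Q :: ('a \<Rightarrow> 'k::{real_normed_field, euclidean_space}) \<Rightarrow> 'a \<Rightarrow> 'k)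
        (Z :: real) f.
       prob_space M \<longrightarrow> operator_on_Lp M Q \<longrightarrow> 0 \<le> Z \<longrightarrow> Lp_growth M b Z lam \<nu> Q \<longrightarrow>
       f \<in> GLS M b \<psi> \<longrightarrow>
         Q f \<in> GLS M b \<zeta> \<and>
         GLS_norm M b \<zeta> (Q f) \<le> ennreal Z * K_const \<nu> \<zeta> b * GLS_norm M b \<psi> f \<and>
         (f \<in> orlicz_space M (young_orlicz C0 \<psi>) \<longrightarrow> Q f \<in> orlicz_space M (young_orlicz C0 \<zeta>)) \<and>
         orlicz_norm M (young_orlicz C0 \<zeta>) (Q f)
           \<le> ennreal C * K_const \<nu> \<zeta> b * ennreal Z * orlicz_norm M (young_orlicz C0 \<psi>) f)"
proof -
  have \<Delta>: "0 \<le> \<Delta>" using assms by simp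
  note \<psi> = \<open>\<psi> \<in> Psi b\<close>
  obtain C where C: "0 < C" and transfer: "\<forall>(M :: 'a measure) F G. prob_space M \<longrightarrow>
    F \<in> borel_measurable M \<longrightarrow> G \<in> borel_measurable M \<longrightarrow> (\<forall>x. 0 \<le> F x) \<longrightarrow> (\<forall>x. 0 \<le> G x) \<longrightarrow>
    (\<forall>q. 1 < q \<longrightarrow> ereal q < b \<longrightarrow> (\<integral>\<^sup>+x. ennreal (G x powr q) \<partial>M)
      \<le> ennreal (((q / (q - 1)) powr \<nu> * q powr \<Delta>) powr q) * (\<integral>\<^sup>+x. ennreal (F x powr q) \<partial>M)) \<longrightarrow>
    (\<integral>\<^sup>+x. young_orlicz C0 \<psi> (F x) \<partial>M) \<le> 1 \<longrightarrow>
    (\<integral>\<^sup>+x. young_orlicz C0 \<zeta> (G x / C) \<partial>M) \<le> 1"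
    using young_orlicz_transfer[OF \<psi> \<open>1 < b\<close> \<open>0 \<le> \<nu>\<close> \<Delta> \<open>0 < C0\<close>] \<open>\<zeta> = _\<close> by blast
  \<comment> \<open>The growth factor of the operator with \<open>lam = \<nu> + \<Delta>\<close>
    split up: \<open>p powr \<Delta>\<close> will be absorbed into \<open>\<zeta>\<close>, and the
    remaining quotient \<open>p / (p - 1)\<close> decreases in \<open>p\<close>.\<close>
  define A where "A p = (p / (p - 1)) powr \<nu> * p powr \<Delta>" for p
  have A0: "0 \<le> A p" for p by (simp add: A_def)

  \<comment> \<open>Size of the constant \<open>K_const\<close>\<close>
  define S where "S = {q. 1 < q \<and> ereal q < b}"
  have "ereal 1 < b" using \<open>1 < b\<close> by (cases b) auto
  then obtain q0 where "ereal 1 < ereal q0" "ereal q0 < b" using ereal_dense2 by blast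
  then have q0: "1 < q0" "ereal q0 < b" by auto
  have K: "K_const \<nu> \<zeta> b = (INF q\<in>S. ennreal ((q / (q - 1)) powr \<nu>) * \<zeta> q)"
    unfolding K_const_def S_def by (intro INF_cong refl) (simp add: K_const_integrand_eq)
  have \<zeta>1: "1 \<le> \<zeta> p" if "1 \<le> p" for p
    using zeta_ge_1[OF \<psi> that \<Delta>] \<open>\<zeta> = _\<close> by simp
  have \<zeta>fin: "\<zeta> p < top" if "1 \<le> p" "ereal p < b" for p
    using zeta_finite_iff[OF \<psi> that(1)] that \<open>\<zeta> = _\<close> by simp
  have ratio1: "1 \<le> (q / (q - 1)) powr \<nu>" if "1 < q" for q
    using that \<open>0 \<le> \<nu>\<close> by (intro ge_one_powr_ge_zero) auto
  \<comment> \<open>The transfer gives an Orlicz bound without \<open>K_const\<close>; the constant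
    may be inserted there because it is at least 1.\<close>
  have K1: "1 \<le> K_const \<nu> \<zeta> b"
    unfolding K
  proof (rule INF_greatest)
    fix q assume "q \<in> S"
    then have q: "1 < q" by (simp add: S_def)
    have "1 * 1 \<le> ennreal ((q / (q - 1)) powr \<nu>) * \<zeta> q"
      using ratio1[OF q] \<zeta>1[of q] q by (intro mult_mono) auto
    then show "1 \<le> ennreal ((q / (q - 1)) powr \<nu>) * \<zeta> q" by simp
  qed
  have Kfin: "K_const \<nu> \<zeta> b < top"
  proof -
    have "K_const \<nu> \<zeta> b \<le> ennreal ((q0 / (q0 - 1)) powr \<nu>) * \<zeta> q0"
      unfolding K by (rule INF_lower) (use q0 in \<open>simp add: S_def\<close>)
    also have "\<dots> < top" using \<zeta>fin[of q0] q0 by (simp add: ennreal_mult_less_top)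
    finally show ?thesis .
  qed
  show ?thesis
  proof (rule exI[of _ C], rule conjI[OF C], intro allI impI)
    fix M :: "'a measure" and Q :: "('a \<Rightarrow> 'k) \<Rightarrow> 'a \<Rightarrow> 'k" and Z :: real and f :: "'a \<Rightarrow> 'k"
    assume M: "prob_space M" and op: "operator_on_Lp M Q" and Z: "0 \<le> Z"
      and growth: "Lp_growth M b Z lam \<nu> Q" and f: "f \<in> GLS M b \<psi>"
    interpret prob_space M by fact
    let ?g = "Q f"

    \<comment> \<open>Lebesgue norms of \<open>f\<close> and \<open>Q f\<close>\<close>
    define N where "N = GLS_norm M b \<psi> f"
    have fM[measurable]: "f \<in> borel_measurable M" and Nfin: "N < top"
      using f by (auto simp: GLS_def N_def)
    have Lpf: "Lp_norm M p f \<le> N * \<psi> p" if p: "1 \<le> p" "ereal p < b" for p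
    proof -
      have "Lp_norm M p f / \<psi> p \<le> N"
        unfolding N_def GLS_norm_def by (rule SUP_upper) (use p in auto)
      then have "Lp_norm M p f / \<psi> p * \<psi> p \<le> N * \<psi> p" by (rule mult_right_mono) simp
      moreover have "\<psi> p \<noteq> 0" "\<psi> p \<noteq> top"
        using Psi_ge_1[OF \<psi> p] Psi_finite[OF \<psi> p] by auto
      ultimately show ?thesis by (simp add: ennreal_divide_times ennreal_divide_self less_top)
    qed
    have fin: "Lp_norm M p f < \<infinity>" if p: "1 \<le> p" "ereal p < b" for p
      using Lpf[OF p] Nfin Psi_finite[OF \<psi> p]
      by (auto simp: ennreal_mult_less_top intro: le_less_trans)
    \<comment> \<open>The operator is specified on the spaces with exponent above 1, and
      \<open>q0\<close> is such an exponent below \<open>b\<close>.\<close>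
    have gM[measurable]: "?g \<in> borel_measurable M"
      using op q0 fin[of q0] by (auto simp: operator_on_Lp_def Lp_space_def)
    have Lpg: "Lp_norm M p ?g \<le> ennreal (Z * A p) * Lp_norm M p f" if p: "1 < p" "ereal p < b" for p
    proof -
      have "f \<in> Lp_space M p" using fin[of p] p by (simp add: Lp_space_def)
      then have "f \<in> Lp_space M p \<inter> (\<Union>r\<in>{1<..}. Lp_space M r)" using p by auto
      then have "Lp_norm M p ?g \<le> growth_bound Z lam \<nu> p (Lp_norm M p f)"
        using growth p unfolding Lp_growth_def by (meson less_imp_le)
      also have "p powr lam / (if \<nu> = 0 then 1 else (p - 1) powr \<nu>) = A p"
        using p assms(5) powr_add[of p \<nu> \<Delta>] by (simp add: A_def powr_divide)
      then have "growth_bound Z lam \<nu> p (Lp_norm M p f) = ennreal (Z * A p) * Lp_norm M p f"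
        using p by (simp add: growth_bound_def)
      finally show ?thesis .
    qed
    have LpgN: "Lp_norm M p ?g \<le> ennreal Z * N * (ennreal ((p / (p - 1)) powr \<nu>) * \<zeta> p)"
      if p: "1 < p" "ereal p < b" for p
    proof -
      have "Lp_norm M p ?g \<le> ennreal (Z * A p) * (N * \<psi> p)"
        using Lpg[OF p] Lpf[of p] p by (meson order_trans mult_left_mono zero_le less_imp_le)
      also have "\<dots> = ennreal Z * N * (ennreal ((p / (p - 1)) powr \<nu>) * \<zeta> p)"
        using p Z \<open>\<zeta> = _\<close> by (simp add: A_def zeta_def ennreal_mult mult_ac)
      finally show ?thesis .
    qed

    \<comment> \<open>The bound in the grand Lebesgue norm\<close>
    have gls: "GLS_norm M b \<zeta> ?g \<le> ennreal Z * N * K_const \<nu> \<zeta> b"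
      unfolding K
    proof (rule le_mult_INF_ennreal)
      show "ennreal Z * N < top" using Nfin by (simp add: ennreal_mult_less_top)
      show "S \<noteq> {} \<or> ennreal Z * N \<noteq> 0" using q0 by (auto simp: S_def)
      fix q assume "q \<in> S"
      then have q: "1 < q" "ereal q < b" by (auto simp: S_def)
      let ?k = "ennreal ((q / (q - 1)) powr \<nu>) * \<zeta> q"
      show "GLS_norm M b \<zeta> ?g \<le> ennreal Z * N * ?k"
        unfolding GLS_norm_def
      proof (rule SUP_least, clarify)
        fix p assume p: "1 \<le> p" "ereal p < b"
        have "Lp_norm M p ?g \<le> \<zeta> p * (ennreal Z * N * ?k)"
        proof (cases "p < q")
          case True
          have "Lp_norm M p ?g \<le> Lp_norm M q ?g"
            using True p by (intro Lp_norm_mono_exponent) auto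
          also have "\<dots> \<le> 1 * (ennreal Z * N * ?k)" using LpgN[OF q] by simp
          also have "\<dots> \<le> \<zeta> p * (ennreal Z * N * ?k)"
            using \<zeta>1[OF p(1)] by (intro mult_right_mono) auto
          finally show ?thesis .
        next
          case False
          then have p1: "1 < p" using q by simp
          have "p / (p - 1) \<le> q / (q - 1)" using False q p1 by (simp add: field_simps)
          then have "ennreal ((p / (p - 1)) powr \<nu>) \<le> ennreal ((q / (q - 1)) powr \<nu>)"
            using p1 \<open>0 \<le> \<nu>\<close> by (intro ennreal_leI powr_mono2) auto
          also have "\<dots> \<le> \<dots> * \<zeta> q" using \<zeta>1[of q] q mult_left_mono[of 1 "\<zeta> q"] by simp
          finally have "\<zeta> p * (ennreal Z * N * ennreal ((p / (p - 1)) powr \<nu>))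
              \<le> \<zeta> p * (ennreal Z * N * ?k)"
            by (intro mult_left_mono) auto
          then show ?thesis using LpgN[OF p1 p(2)] by (simp add: mult_ac)
        qed
        then show "Lp_norm M p ?g / \<zeta> p \<le> ennreal Z * N * ?k"
          using \<zeta>1[OF p(1)] by (intro divide_le_posI_ennreal less_le_trans[OF zero_less_one]) auto
      qed
    qed

    \<comment> \<open>The bound in the Orlicz norm\<close>
    have orlicz: "orlicz_norm M (young_orlicz C0 \<zeta>) ?g
        \<le> ennreal (C * Z) * orlicz_norm M (young_orlicz C0 \<psi>) f"
    proof (cases "Z = 0")
      case True
      \<comment> \<open>The scaling by \<open>Z * k\<close> in the other case would divide by 0.
        Here \<open>Q f\<close> vanishes almost everywhere, so every positive scale is admissible
        and the infimum of the scales is 0.\<close>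
      have "Lp_norm M q0 ?g \<le> ennreal 0" using Lpg[OF q0] True by simp
      then have "(\<integral>\<^sup>+x. ennreal (norm (?g x) powr q0) \<partial>M) = 0"
        using q0 by (subst (asm) Lp_norm_le_iff) auto
      then have "AE x in M. norm (?g x) = 0"
        by (subst (asm) nn_integral_0_iff_AE) auto
      then have AE0: "AE x in M. young_orlicz C0 \<zeta> (norm (?g x) / k) = 0" for k
        by (rule eventually_mono) (auto simp: young_orlicz_def not_le)
      have int0: "(\<integral>\<^sup>+x. young_orlicz C0 \<zeta> (norm (?g x) / k) \<partial>M) = 0" for k
        using nn_integral_cong_AE[OF AE0[of k]] by simp
      have le: "orlicz_norm M (young_orlicz C0 \<zeta>) ?g \<le> ennreal k" if "0 < k" for k
        unfolding orlicz_norm_def by (rule INF_lower) (simp add: that int0)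
      have "orlicz_norm M (young_orlicz C0 \<zeta>) ?g \<le> 0"
        by (rule ennreal_le_epsilon) (simp add: le)
      then show ?thesis by simp
    next
      case False
      then have Z0: "0 < Z" using Z by simp
      show ?thesis
        unfolding orlicz_norm_def[of M _ f]
      proof (rule le_mult_INF_ennreal)
        show "{k. 0 < k \<and> (\<integral>\<^sup>+x. young_orlicz C0 \<psi> (norm (f x) / k) \<partial>M) \<le> 1} \<noteq> {} \<or> ennreal (C * Z) \<noteq> 0"
          using C Z0 by simp
        fix k assume "k \<in> {k. 0 < k \<and> (\<integral>\<^sup>+x. young_orlicz C0 \<psi> (norm (f x) / k) \<partial>M) \<le> 1}"
        then have k: "0 < k" and intf: "(\<integral>\<^sup>+x. young_orlicz C0 \<psi> (norm (f x) / k) \<partial>M) \<le> 1" by auto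
        \<comment> \<open>Dividing \<open>Q f\<close> by \<open>Z\<close> removes \<open>Z\<close>
          from the moment bound, so that \<open>C\<close> stays independent of the operator; the
          scale found for \<open>Q f\<close> is \<open>C * Z * k\<close>.\<close>
        define F where "F x = norm (f x) / k" for x
        define G where "G x = norm (?g x) / (Z * k)" for x
        have mom: "(\<integral>\<^sup>+x. ennreal (G x powr q) \<partial>M)
          \<le> ennreal (((q / (q - 1)) powr \<nu> * q powr \<Delta>) powr q) * (\<integral>\<^sup>+x. ennreal (F x powr q) \<partial>M)"
          if q: "1 < q" "ereal q < b" for q
        proof -
          define J where "J = (\<integral>\<^sup>+x. ennreal (norm (f x) powr q) \<partial>M)"
          have "(\<integral>\<^sup>+x. ennreal (G x powr q) \<partial>M)
              = ennreal ((1 / (Z * k)) powr q) * (\<integral>\<^sup>+x. ennreal (norm (?g x) powr q) \<partial>M)"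
            using Z0 k by (subst nn_integral_cmult[symmetric])
              (auto simp: G_def powr_divide simp flip: ennreal_mult)
          also have "\<dots> \<le> ennreal ((1 / (Z * k)) powr q) * (ennreal ((Z * A q) powr q) * J)"
            unfolding J_def using q fin[of q] Lpg[OF q] Z A0
            by (intro mult_left_mono nn_integral_powr_le_of_Lp_norm_le) auto
          also have "\<dots> = ennreal (A q powr q) * (ennreal ((1 / k) powr q) * J)"
            using Z0 k A0[of q]
            by (simp add: powr_divide powr_mult mult.assoc[symmetric] flip: ennreal_mult)
          also have "ennreal ((1 / k) powr q) * J = (\<integral>\<^sup>+x. ennreal (F x powr q) \<partial>M)"
            unfolding J_def using k by (subst nn_integral_cmult[symmetric])
              (auto simp: F_def powr_divide simp flip: ennreal_mult)
          finally show ?thesis by (simp add: A_def)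
        qed
        have [measurable]: "F \<in> borel_measurable M" "G \<in> borel_measurable M"
          unfolding F_def G_def by measurable
        have "(\<integral>\<^sup>+x. young_orlicz C0 \<zeta> (G x / C) \<partial>M) \<le> 1"
          using mom intf Z0 k M
          by (intro transfer[rule_format, of M F G]) (simp_all add: F_def G_def)
        then have "orlicz_norm M (young_orlicz C0 \<zeta>) ?g \<le> ennreal (C * Z * k)"
          unfolding orlicz_norm_def using C Z0 k
          by (intro INF_lower) (simp add: G_def mult_ac)
        then show "orlicz_norm M (young_orlicz C0 \<zeta>) ?g \<le> ennreal (C * Z) * ennreal k"
          using C Z0 k by (simp add: ennreal_mult)
      qed simp
    qed
    have orlicz': "orlicz_norm M (young_orlicz C0 \<zeta>) ?g
        \<le> ennreal C * K_const \<nu> \<zeta> b * ennreal Z * orlicz_norm M (young_orlicz C0 \<psi>) f"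
    proof -
      have "ennreal (C * Z) * 1 \<le> ennreal (C * Z) * K_const \<nu> \<zeta> b"
        by (rule mult_left_mono[OF K1]) simp
      then have "ennreal (C * Z) \<le> ennreal C * K_const \<nu> \<zeta> b * ennreal Z"
        using C Z by (simp add: ennreal_mult mult_ac)
      then show ?thesis using orlicz by (meson order_trans mult_right_mono zero_le)
    qed
    show "?g \<in> GLS M b \<zeta> \<and>
         GLS_norm M b \<zeta> ?g \<le> ennreal Z * K_const \<nu> \<zeta> b * GLS_norm M b \<psi> f \<and>
         (f \<in> orlicz_space M (young_orlicz C0 \<psi>) \<longrightarrow> ?g \<in> orlicz_space M (young_orlicz C0 \<zeta>)) \<and>
         orlicz_norm M (young_orlicz C0 \<zeta>) ?g
           \<le> ennreal C * K_const \<nu> \<zeta> b * ennreal Z * orlicz_norm M (young_orlicz C0 \<psi>) f"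
    proof (intro conjI impI)
      show "GLS_norm M b \<zeta> ?g \<le> ennreal Z * K_const \<nu> \<zeta> b * GLS_norm M b \<psi> f"
        using gls by (simp add: N_def mult_ac)
      have "ennreal Z * N * K_const \<nu> \<zeta> b < top"
        using Nfin Kfin by (simp add: ennreal_mult_less_top)
      then show "?g \<in> GLS M b \<zeta>" using gls by (auto simp: GLS_def intro: le_less_trans)
      show "orlicz_norm M (young_orlicz C0 \<zeta>) ?g
           \<le> ennreal C * K_const \<nu> \<zeta> b * ennreal Z * orlicz_norm M (young_orlicz C0 \<psi>) f"
        by (rule orlicz')
      assume "f \<in> orlicz_space M (young_orlicz C0 \<psi>)"
      then have "ennreal C * K_const \<nu> \<zeta> b * ennreal Z * orlicz_norm M (young_orlicz C0 \<psi>) f < top"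
        using Kfin by (simp add: orlicz_space_def ennreal_mult_less_top)
      then show "?g \<in> orlicz_space M (young_orlicz C0 \<zeta>)"
        using orlicz' by (auto simp: orlicz_space_def intro: le_less_trans)
    qed
  qed
qed

end
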